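(* Fix $0<q<1$ and $0<p<2$. 1. (Worst-case ideal risk.) $$\lim_{\eta\to0}\left[\frac{\sup_{G\in\mathcal G_p(\eta)}\tilde{\mathcal R}(T_q,G)}{\eta^p\log^{2-p}\log\frac1\eta}\right]=\begin{cases}1,&0<q\le\frac12,\\ \frac{q}{1-q},&\frac12<q<1.\end{cases}$$ 2. (Least favorable scale mixture.) Fix $0\le s\le1$. Set $\mu_b^*(\eta)=\log(\frac1\eta)/\log\log(\frac1\eta)$ and $\mu_v^*(\eta)=\log(\frac1\eta)\cdot\log\log(\frac1\eta)$, and define $\tilde\mu=\mu_b^*(\eta)$ if $0<q<\frac12$, $\tilde\mu=\mu_v^*(\eta)$ if $\frac12<q<1$, and $\tilde\mu=(1-s)\mu_b^*(\eta)+s\mu_v^*(\eta)$ if $q=\frac12$. For $\mu>1$ let $G_{\varepsilon,\mu}=(1-\varepsilon)E(\cdot)+\varepsilon E(\cdot/\mu)$ with $\varepsilon=\eta^p/\log^p(\mu)$. Then $$\lim_{\eta\to0}\left[\frac{\tilde{\mathcal R}(T_q,G_{\varepsilon,\tilde\mu})}{\sup_{G\in\mathcal G_p(\eta)}\tilde{\mathcal R}(T_q,G)}\right]=1.$$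
   Context: $E(t)=1-e^{-t}$ ($t\ge0$) is the standard exponential cdf, $\bar E=1-E$; for a cdf $G$, $\bar G=1-G$. $\mathcal F$ is the set of probability distributions on $[1,\infty)$; for $F\in\mathcal F$, $E\#F$ is the cdf $G(t)=\int E(t/\mu)\,dF(\mu)$, i.e. the law of $X$ when $\mu\sim F$ and $X\mid\mu\sim\mathrm{Exp}(\mu)$ (mean $\mu$). $\mathcal G_p(\eta)=\{E\#F:F\in\mathcal F,\ \int\log^p(\mu)\,dF(\mu)\le\eta^p\}$. FDR functional: $T_q(G)=\inf\{t:\bar G(t)\ge\frac1q\bar E(t)\}$ (with $\inf\emptyset=+\infty$). Ideal risk: for $G=E\#F$, $\tilde{\mathcal R}(T_q,G)=\mathbb{E}\big(\log\delta_{T_q(G)}(X)-\log\mu\big)^2$ where $\mu\sim F$, $X\mid\mu\sim\mathrm{Exp}(\mu)$, and $\delta_t(x)=x$ if $x\ge t$, $\delta_t(x)=1$ otherwise (for $t=+\infty$, $\delta_t\equiv1$). *)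

theory Defs
  imports "HOL-Probability.Probability"
begin

definition Ecdf :: "real \<Rightarrow> real" where
  "Ecdf t = (if t < 0 then 0 else 1 - exp (- t))"

definition mixcdf :: "real measure \<Rightarrow> real \<Rightarrow> real" where
  "mixcdf F t = (\<integral>\<mu>. Ecdf (t / \<mu>) \<partial>F)"

text \<open>FDR functional T_q(G) = inf{t : 1 - G t >= (1/q)(1 - E t)}, with inf of empty = +infinity.\<close>
definition Tq :: "real \<Rightarrow> (real \<Rightarrow> real) \<Rightarrow> ereal" where
  "Tq q G = Inf {ereal t | t. 1 - G t \<ge> (1 / q) * (1 - Ecdf t)}"

definition delta :: "ereal \<Rightarrow> real \<Rightarrow> real" where
  "delta t x = (if ereal x \<ge> t then x else 1)"

text \<open>Ideal risk: E (log delta_T(X) - log mu)^2, mu ~ F, X | mu ~ Exp with mean mu (density exp(-x/mu)/mu on x >= 0).\<close>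
definition ideal_risk :: "real \<Rightarrow> real measure \<Rightarrow> ennreal" where
  "ideal_risk q F =
     (\<integral>\<^sup>+ \<mu>. (\<integral>\<^sup>+ x. ennreal (indicator {0..} x * (exp (- x / \<mu>) / \<mu>)
         * (ln (delta (Tq q (mixcdf F)) x) - ln \<mu>)\<^sup>2) \<partial>lborel) \<partial>F)"

text \<open>Mixing distributions F on [1,oo) with int log^p(mu) dF <= eta^p; G_p(eta) = {E#F : F in this set}.\<close>
definition Fclass :: "real \<Rightarrow> real \<Rightarrow> real measure set" where
  "Fclass p \<eta> = {F. prob_space F \<and> sets F = sets borel \<and> (AE \<mu> in F. 1 \<le> \<mu>)
      \<and> (\<integral>\<^sup>+ \<mu>. ennreal ((ln \<mu>) powr p) \<partial>F) \<le> ennreal (\<eta> powr p)}"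

text \<open>Two-point mixing law (1-eps) delta_1 + eps delta_mu, so E#F = (1-eps)E(.) + eps E(./mu).\<close>
definition two_point :: "real \<Rightarrow> real \<Rightarrow> real measure" where
  "two_point \<epsilon> \<mu> = measure_pmf (map_pmf (\<lambda>b. if b then \<mu> else 1) (bernoulli_pmf \<epsilon>))"

end

theory Submission
  imports Defs "HOL-Real_Asymp.Real_Asymp"
begin

text \<open>
  Write \<open>\<gamma> = q / (1 - q)\<close> and let \<open>T\<close> be the threshold. Unless \<open>F\<close> is the point mass at 1 (where the
  risk vanishes), \<open>T\<close> is finite and \<open>\<integral> (e^(-T/\<mu>) - e^(-T)) dF = e^(-T) / \<gamma>\<close>. The risk is the integral
  over \<open>F\<close> of the bias \<open>(1 - e^(-T/\<mu>)) ln\<^sup>2 \<mu>\<close> plus a variance that is about \<open>e^(-T/\<mu>) ln\<^sup>2 (T/\<mu>)\<close>.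
  The mass of \<open>F\<close> near 1 therefore contributes \<open>e^(-T) ln\<^sup>2 T\<close>, which the threshold equation turns into
  \<open>\<gamma> ln\<^sup>2 T \<integral> (e^(-T/\<mu>) - e^(-T)) dF\<close>. So the effective cost of a mean \<open>\<mu>\<close> is about
  \<open>(1 - e^(-T/\<mu>)) ln\<^sup>2 \<mu> + \<gamma> e^(-T/\<mu>) ln\<^sup>2 T\<close>, and relative to \<open>ln^p \<mu>\<close> this is largest when \<open>ln \<mu>\<close> is
  close to \<open>ln T\<close>, with value \<open>max 1 \<gamma> * ln^(2-p) T\<close>. The moment constraint forces
  \<open>e^(-T) = O(\<eta>^p)\<close>; if \<open>T\<close> exceeds \<open>2 p ln (1/\<eta>)\<close>, then \<open>F\<close> has so little mass beyond 4 that the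
  risk is \<open>O(\<eta>^p)\<close>, and otherwise \<open>ln T\<close> is at most about \<open>ln (ln (1/\<eta>))\<close>. For the two-point laws
  \<open>T\<close> is explicit and asymptotic to \<open>p ln (1/\<eta>)\<close>, so \<open>T/\<mu>\<close> tends to infinity or to 0 for the two
  extreme choices of \<open>\<mu>\<close>, which selects the bias or the variance term.
\<close>

section \<open>The logarithmic second moment of the exponential tail\<close>

text \<open>For \<open>Y\<close> standard exponential this is the mean of \<open>(ln Y)^2\<close>
  over the event \<open>Y >= a\<close>. An observation with mean \<mu> is
  \<open>X = \<mu> * Y\<close>, so \<open>a = T / \<mu>\<close> gives its squared log error above
  the threshold \<open>T\<close>. The integral is finite for \<open>a >= 0\<close>, where
  \<open>enn2real\<close> therefore loses nothing.\<close>

definition log_sq_tail :: "real \<Rightarrow> real" where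
  "log_sq_tail a = enn2real (\<integral>\<^sup>+ y. ennreal (exp (- y) * (ln y)\<^sup>2) * indicator {a..} y \<partial>lborel)"

text \<open>Both terms of the majorant integrate against \<open>exp (- y)\<close> over the half
  line, to \<open>16 * Gamma (1/2)\<close> and \<open>fact 2\<close>. The first is
  \<open>ln z <= z\<close> at \<open>z = y powr (-1/4)\<close>, squared, and controls the
  singularity at 0.\<close>

lemma ln_sq_le:
  fixes y :: real
  assumes "0 < y"
  shows "(ln y)\<^sup>2 \<le> 16 * y powr (- 1 / 2) + y\<^sup>2"
proof (cases "y \<le> 1")
  case True
  have "ln (y powr (-1/4)) \<le> y powr (-1/4)"
    using ln_le_minus_one[of "y powr (-1/4)"] assms by simp
  then have "- ln y \<le> 4 * y powr (-1/4)"
    using assms by (simp add: ln_powr)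
  moreover have "0 \<le> - ln y" using True assms by simp
  ultimately have "(- ln y)\<^sup>2 \<le> (4 * y powr (-1/4))\<^sup>2"
    by (intro power_mono)
  also have "\<dots> = 16 * y powr (-1/2)"
    using assms by (simp add: power2_eq_square powr_add[symmetric])
  finally show ?thesis by (simp add: add_increasing2)
next
  case False
  then have "ln y \<le> y" "0 \<le> ln y" using ln_le_minus_one[of y] by auto
  then have "(ln y)\<^sup>2 \<le> y\<^sup>2" by (intro power_mono)
  then show ?thesis by (simp add: add_increasing)
qed

lemma nn_integral_log_sq_finite:
  assumes "0 \<le> a"
  shows "(\<integral>\<^sup>+ y. ennreal (exp (- y) * (ln y)\<^sup>2) * indicator {a..} y \<partial>lborel) < \<infinity>"
proof -
  have "(\<integral>\<^sup>+ y. ennreal (exp (- y) * (ln y)\<^sup>2) * indicator {a..} y \<partial>lborel)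
     \<le> (\<integral>\<^sup>+ y. ennreal 16 * ennreal (indicator {0..} y * y powr (1/2 - 1) / exp y)
          + ennreal (y ^ 2 * exp (- y)) * indicator {0..} y \<partial>lborel)"
  proof (rule nn_integral_mono)
    fix y :: real
    show "ennreal (exp (- y) * (ln y)\<^sup>2) * indicator {a..} y
       \<le> ennreal 16 * ennreal (indicator {0..} y * y powr (1/2 - 1) / exp y)
          + ennreal (y ^ 2 * exp (- y)) * indicator {0..} y"
    proof (cases "a \<le> y \<and> 0 < y")
      case True
      then have "(ln y)\<^sup>2 * exp (- y) \<le> (16 * y powr (- 1 / 2) + y\<^sup>2) * exp (- y)"
        by (intro mult_right_mono ln_sq_le) auto
      then have "ennreal (exp (- y) * (ln y)\<^sup>2)
          \<le> ennreal (16 * (y powr (1/2 - 1) / exp y) + y ^ 2 * exp (- y))"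
        by (intro ennreal_leI) (simp add: exp_minus field_simps)
      also have "\<dots> = ennreal 16 * ennreal (y powr (1/2 - 1) / exp y) + ennreal (y ^ 2 * exp (- y))"
        by (subst ennreal_plus, simp, simp, subst ennreal_mult, auto)
      finally show ?thesis using True by simp
    next
      case False
      \<comment> \<open>The only point of \<open>{a..}\<close> that can occur here is
        \<open>y = 0\<close>, where the default \<open>ln 0 = 0\<close> makes the integrand
        vanish.\<close>
      then show ?thesis using assms by (cases "y = 0") (auto simp: indicator_def)
    qed
  qed
  also have "\<dots> = ennreal 16 * ennreal (Gamma (1/2)) + ennreal (fact 2)"
    using nn_intergal_power_times_exp_Ici[of 2]
    by (simp add: nn_integral_add nn_integral_cmult Gamma_conv_nn_integral_real)
  also have "\<dots> < \<infinity>" by (simp add: ennreal_mult_less_top)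
  finally show ?thesis .
qed

lemma ennreal_log_sq_tail:
  assumes "0 \<le> a"
  shows "ennreal (log_sq_tail a) = (\<integral>\<^sup>+ y. ennreal (exp (- y) * (ln y)\<^sup>2) * indicator {a..} y \<partial>lborel)"
  using nn_integral_log_sq_finite[OF assms] unfolding log_sq_tail_def by simp

lemma log_sq_tail_nonneg: "0 \<le> log_sq_tail a"
  unfolding log_sq_tail_def by simp

lemma log_sq_tail_antimono:
  assumes "0 \<le> a" "a \<le> b"
  shows "log_sq_tail b \<le> log_sq_tail a"
proof -
  have "ennreal (log_sq_tail b) \<le> ennreal (log_sq_tail a)"
    using assms by (subst (1 2) ennreal_log_sq_tail) (auto intro!: nn_integral_mono simp: indicator_def)
  then show ?thesis by (simp add: log_sq_tail_nonneg)
qed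

text \<open>Beyond \<open>a >= 1\<close> the squared logarithm stays above its value at
  \<open>a\<close>, and the exponential mass there is \<open>exp (- a)\<close>.\<close>

lemma log_sq_tail_lower:
  assumes "1 \<le> a"
  shows "exp (- a) * (ln a)\<^sup>2 \<le> log_sq_tail a"
proof -
  have "(\<integral>\<^sup>+ y. ennreal (exp (- y)) * indicator {a..} y \<partial>lborel) = ennreal (0 - (- exp (- a)))"
    by (rule nn_integral_FTC_atLeast) (auto intro!: derivative_eq_intros, real_asymp)
  then have "ennreal (exp (- a) * (ln a)\<^sup>2)
      = (\<integral>\<^sup>+ y. ennreal ((ln a)\<^sup>2) * (ennreal (exp (- y)) * indicator {a..} y) \<partial>lborel)"
    by (subst nn_integral_cmult) (auto simp: ennreal_mult[symmetric] mult.commute)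
  also have "\<dots> \<le> ennreal (log_sq_tail a)"
    using assms by (subst ennreal_log_sq_tail)
      (auto intro!: nn_integral_mono mult_right_mono power_mono ennreal_leI
        simp: indicator_def ennreal_mult[symmetric] mult.commute)
  finally show ?thesis by (simp add: log_sq_tail_nonneg)
qed

text \<open>Beyond \<open>a >= 1\<close> the logarithm has slope at most 1, so
  \<open>ln y <= ln a + (y - a)\<close>. The resulting polynomial times \<open>exp (- y)\<close> has
  the explicit antiderivative \<open>F\<close>, and \<open>- F a\<close> is the bound.\<close>

lemma log_sq_tail_upper:
  assumes "1 \<le> a"
  shows "log_sq_tail a \<le> exp (- a) * ((ln a + 1)\<^sup>2 + 1)"
proof -
  define f where "f y = exp (- y) * (ln a + (y - a))\<^sup>2" for y
  define F where "F y = - exp (- y) * ((ln a + (y - a))\<^sup>2 + 2 * (ln a + (y - a)) + 2)" for y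
  have "ennreal (log_sq_tail a) \<le> (\<integral>\<^sup>+ y. ennreal (f y) * indicator {a..} y \<partial>lborel)"
  proof -
    have "exp (- y) * (ln y)\<^sup>2 \<le> f y" if "a \<le> y" for y
    proof -
      have "y / a \<le> 1 + (y - a)"
        using that assms mult_nonneg_nonneg[of "a - 1" "y - a"] by (simp add: field_simps)
      then have "ln (y / a) \<le> y - a"
        using ln_le_minus_one[of "y / a"] that assms by simp
      then have "ln y \<le> ln a + (y - a)" using that assms by (simp add: ln_div)
      moreover have "0 \<le> ln y" using that assms by simp
      ultimately show ?thesis unfolding f_def by (intro mult_left_mono power_mono) auto
    qed
    then show ?thesis using assms by (subst ennreal_log_sq_tail)
      (auto intro!: nn_integral_mono ennreal_leI simp: indicator_def)
  qed
  also have "\<dots> = ennreal (0 - F a)"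
  proof (rule nn_integral_FTC_atLeast)
    show "f \<in> borel_measurable borel" unfolding f_def by measurable
    show "(F has_real_derivative f x) (at x)" for x
      unfolding F_def f_def
      by (auto intro!: derivative_eq_intros simp: power2_eq_square algebra_simps)
    show "0 \<le> f x" for x by (simp add: f_def)
    show "(F \<longlongrightarrow> 0) at_top" unfolding F_def by real_asymp
  qed
  finally have "log_sq_tail a \<le> - F a"
    using assms by (subst (asm) ennreal_le_iff) (auto simp: F_def intro!: mult_nonneg_nonneg add_nonneg_nonneg)
  then show ?thesis by (simp add: F_def power2_eq_square algebra_simps)
qed

text \<open>The last summand covers arguments below 1, where the logarithm is unbounded.\<close>

definition tail_factor :: "real \<Rightarrow> real" where
  "tail_factor T = (ln T + 1)\<^sup>2 + 1 + exp 1 * log_sq_tail 0"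

lemma tail_factor_ge_1: "1 \<le> tail_factor T"
  unfolding tail_factor_def using log_sq_tail_nonneg[of 0] by (simp add: add_increasing)

text \<open>For \<open>a <= 1\<close> the factor \<open>exp (- a) * exp 1\<close> is at least 1, so
  the constant \<open>log_sq_tail 0\<close> suffices. For \<open>a > 1\<close> the previous bound
  applies with \<open>ln a <= ln T\<close>.\<close>

lemma log_sq_tail_le:
  assumes "1 \<le> T" "0 \<le> a" "a \<le> T"
  shows "log_sq_tail a \<le> exp (- a) * tail_factor T"
proof (cases "a \<le> 1")
  case True
  have "1 * log_sq_tail 0 \<le> (exp (- a) * exp 1) * log_sq_tail 0"
    using True by (intro mult_right_mono log_sq_tail_nonneg) (simp add: exp_add[symmetric])
  then have "log_sq_tail a \<le> exp (- a) * (exp 1 * log_sq_tail 0)"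
    using log_sq_tail_antimono[of 0 a] assms by simp
  also have "\<dots> \<le> exp (- a) * tail_factor T"
    unfolding tail_factor_def by (intro mult_left_mono) auto
  finally show ?thesis .
next
  case False
  have "log_sq_tail a \<le> exp (- a) * ((ln a + 1)\<^sup>2 + 1)"
    using False by (intro log_sq_tail_upper) simp
  also have "\<dots> \<le> exp (- a) * tail_factor T"
    unfolding tail_factor_def using False assms log_sq_tail_nonneg[of 0]
    by (intro mult_left_mono add_increasing2 add_right_mono power_mono) auto
  finally show ?thesis .
qed

section \<open>Threshold and risk of a mixture\<close>

text \<open>The risk conditional on the mean. Below \<open>T\<close>, an event of probability
  \<open>1 - exp (- T / \<mu>)\<close>, the estimate is 1 and the loss is
  \<open>(ln \<mu>)^2\<close>; above \<open>T\<close> the estimate is \<open>X\<close>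
  itself.\<close>

definition cell_risk :: "real \<Rightarrow> real \<Rightarrow> real" where
  "cell_risk T \<mu> = (1 - exp (- T / \<mu>)) * (ln \<mu>)\<^sup>2 + log_sq_tail (T / \<mu>)"

lemma cell_risk_nonneg: "0 \<le> T \<Longrightarrow> 0 < \<mu> \<Longrightarrow> 0 \<le> cell_risk T \<mu>"
  unfolding cell_risk_def by (intro add_nonneg_nonneg mult_nonneg_nonneg log_sq_tail_nonneg) auto

lemma nn_integral_cell_risk:
  assumes "0 < T" "1 \<le> \<mu>"
  shows "(\<integral>\<^sup>+ x. ennreal (indicator {0..} x * (exp (- x / \<mu>) / \<mu>)
         * (ln (delta (ereal T) x) - ln \<mu>)\<^sup>2) \<partial>lborel) = ennreal (cell_risk T \<mu>)" (is "?I = _")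
proof -
  have \<mu>: "0 < \<mu>" using assms by simp
  define f where "f y = ennreal ((ln \<mu>)\<^sup>2) * (ennreal (exp (- y)) * indicator {0..T / \<mu>} y)" for y
  define g where "g y = ennreal (exp (- y) * (ln y)\<^sup>2) * indicator {T / \<mu>..} y" for y
  \<comment> \<open>The substitution \<open>x = \<mu> * y\<close> standardizes the exponential, and
    \<open>ln x - ln \<mu>\<close> becomes \<open>ln y\<close>.\<close>
  have "?I = ennreal \<bar>\<mu>\<bar> * (\<integral>\<^sup>+ y. ennreal (indicator {0..} (0 + \<mu> * y)
        * (exp (- (0 + \<mu> * y) / \<mu>) / \<mu>) * (ln (delta (ereal T) (0 + \<mu> * y)) - ln \<mu>)\<^sup>2) \<partial>lborel)"
    using \<mu> by (intro nn_integral_real_affine) (auto simp: delta_def)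
  also have "\<dots> = (\<integral>\<^sup>+ y. ennreal \<bar>\<mu>\<bar> * ennreal (indicator {0..} (0 + \<mu> * y)
        * (exp (- (0 + \<mu> * y) / \<mu>) / \<mu>) * (ln (delta (ereal T) (0 + \<mu> * y)) - ln \<mu>)\<^sup>2) \<partial>lborel)"
    by (subst nn_integral_cmult) (auto simp: delta_def)
  also have "\<dots> = (\<integral>\<^sup>+ y. f y + g y \<partial>lborel)"
  \<comment> \<open>At \<open>y = T / \<mu>\<close> both indicators equal 1, so the splitting is
    claimed only off this null set.\<close>
  proof (rule nn_integral_cong_AE, use AE_lborel_singleton[of "T / \<mu>"] in eventually_elim)
    fix y assume y: "y \<noteq> T / \<mu>"
    consider "y < 0" | "0 \<le> y" "y < T / \<mu>" | "T / \<mu> < y" using y by linarith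
    then show "ennreal \<bar>\<mu>\<bar> * ennreal (indicator {0..} (0 + \<mu> * y) * (exp (- (0 + \<mu> * y) / \<mu>) / \<mu>)
        * (ln (delta (ereal T) (0 + \<mu> * y)) - ln \<mu>)\<^sup>2) = f y + g y"
    proof cases
      case 1
      then have "\<not> 0 \<le> \<mu> * y" "\<not> T / \<mu> \<le> y" using \<mu> assms
        by (auto simp: zero_le_mult_iff not_le intro: less_trans[of y 0])
      with 1 show ?thesis by (simp add: f_def g_def)
    next
      case 2
      then have "\<mu> * y < T" "0 \<le> \<mu> * y" using \<mu> by (auto simp: field_simps)
      then show ?thesis using 2 \<mu>
        by (simp add: f_def g_def delta_def ennreal_mult[symmetric] mult.commute)
    next
      case 3
      then have "T < \<mu> * y" using \<mu> by (simp add: field_simps)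
      moreover have "0 < y" using 3 assms \<mu> by (meson divide_pos_pos less_trans)
      ultimately show ?thesis using 3 \<mu> assms
        by (simp add: f_def g_def delta_def ennreal_mult[symmetric] ln_mult mult.commute)
    qed
  qed
  also have "\<dots> = (\<integral>\<^sup>+ y. f y \<partial>lborel) + (\<integral>\<^sup>+ y. g y \<partial>lborel)"
    unfolding f_def g_def by (subst nn_integral_add) auto
  also have "(\<integral>\<^sup>+ y. g y \<partial>lborel) = ennreal (log_sq_tail (T / \<mu>))"
    unfolding g_def using assms by (subst ennreal_log_sq_tail) auto
  also have "(\<integral>\<^sup>+ y. f y \<partial>lborel) = ennreal ((1 - exp (- T / \<mu>)) * (ln \<mu>)\<^sup>2)"
  proof -
    have "(\<integral>\<^sup>+ y. ennreal (exp (- y)) * indicator {0..T / \<mu>} y \<partial>lborel)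
        = ennreal (- exp (- (T / \<mu>)) - (- exp (- 0)))"
      using assms by (intro nn_integral_FTC_Icc) (auto intro!: derivative_eq_intros)
    moreover have "0 \<le> 1 - exp (- T / \<mu>)" using assms by simp
    ultimately show ?thesis unfolding f_def
      by (subst nn_integral_cmult) (auto simp: ennreal_mult[symmetric] mult.commute)
  qed
  finally show ?thesis
    using assms log_sq_tail_nonneg by (simp add: cell_risk_def ennreal_plus)
qed

section \<open>Survival function of a mixture and the threshold equation\<close>

locale mixing = prob_space F for F :: "real measure" +
  assumes sets_F: "sets F = sets borel"
    and AE_ge_1: "AE \<mu> in F. 1 \<le> \<mu>"
begin

lemma measurable_F [measurable_cong]: "sets F = sets borel"
  by (rule sets_F)

lemma integrable_exp:
  assumes "0 \<le> t"
  shows "integrable F (\<lambda>\<mu>. exp (- t / \<mu>))"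
proof (rule integrable_const_bound[where B=1])
  show "AE \<mu> in F. norm (exp (- t / \<mu>)) \<le> 1"
    using AE_ge_1 by eventually_elim (use assms in simp)
qed measurable

lemma one_minus_mixcdf:
  assumes "0 \<le> t"
  shows "1 - mixcdf F t = (\<integral>\<mu>. exp (- t / \<mu>) \<partial>F)"
proof -
  have "mixcdf F t = (\<integral>\<mu>. 1 - exp (- t / \<mu>) \<partial>F)"
    unfolding mixcdf_def
  proof (rule integral_cong_AE)
    show "AE \<mu> in F. Ecdf (t / \<mu>) = 1 - exp (- t / \<mu>)"
      using AE_ge_1 by eventually_elim (use assms in \<open>auto simp: Ecdf_def not_less divide_less_0_iff\<close>)
  qed (unfold Ecdf_def, measurable)
  also have "\<dots> = 1 - (\<integral>\<mu>. exp (- t / \<mu>) \<partial>F)"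
    using integrable_exp[OF assms] by (simp add: prob_space)
  finally show ?thesis by simp
qed

lemma mixcdf_neg:
  assumes "t < 0"
  shows "mixcdf F t = 0"
proof -
  have "mixcdf F t = (\<integral>\<mu>. 0 \<partial>F)"
    unfolding mixcdf_def
  proof (rule integral_cong_AE)
    show "AE \<mu> in F. Ecdf (t / \<mu>) = 0"
      using AE_ge_1 by eventually_elim (use assms in \<open>auto simp: Ecdf_def divide_less_0_iff\<close>)
  qed (unfold Ecdf_def, measurable)
  then show ?thesis by simp
qed

text \<open>Since \<open>\<mu> >= 1\<close>, every \<open>exp (- t / \<mu>)\<close> is 1-Lipschitz
  in \<open>t >= 0\<close>, and averaging preserves this. The continuity obtained turns the
  threshold inequality into an equation.\<close>

lemma exp_integral_lipschitz:
  assumes "0 \<le> s" "s \<le> t"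
  shows "\<bar>(\<integral>\<mu>. exp (- t / \<mu>) \<partial>F) - (\<integral>\<mu>. exp (- s / \<mu>) \<partial>F)\<bar> \<le> t - s"
proof -
  have "(\<integral>\<mu>. exp (- s / \<mu>) \<partial>F) - (\<integral>\<mu>. exp (- t / \<mu>) \<partial>F)
      = (\<integral>\<mu>. exp (- s / \<mu>) - exp (- t / \<mu>) \<partial>F)"
    using assms by (intro Bochner_Integration.integral_diff[symmetric] integrable_exp) auto
  moreover have "(\<integral>\<mu>. exp (- s / \<mu>) - exp (- t / \<mu>) \<partial>F) \<le> (\<integral>\<mu>. t - s \<partial>F)"
  proof (rule integral_mono_AE)
    show "AE \<mu> in F. exp (- s / \<mu>) - exp (- t / \<mu>) \<le> t - s"
      using AE_ge_1
    proof eventually_elim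
      case (elim \<mu>)
      have "exp (- s / \<mu>) * (1 - exp (- ((t - s) / \<mu>))) \<le> 1 * ((t - s) / \<mu>)"
        using assms elim exp_ge_add_one_self[of "- ((t - s) / \<mu>)"]
        by (intro mult_mono) auto
      also have "\<dots> \<le> t - s"
        using assms elim mult_left_mono[of 1 \<mu> "t - s"] by (simp add: field_simps)
      finally show ?case
        by (simp add: right_diff_distrib exp_add[symmetric] diff_divide_distrib)
    qed
  qed (use assms in \<open>auto intro!: integrable_exp[unfolded minus_divide_left[symmetric]]
         Bochner_Integration.integrable_diff\<close>)
  moreover have "0 \<le> (\<integral>\<mu>. exp (- s / \<mu>) - exp (- t / \<mu>) \<partial>F)"
  proof (rule integral_nonneg_AE)
    show "AE \<mu> in F. 0 \<le> exp (- s / \<mu>) - exp (- t / \<mu>)"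
      using AE_ge_1 by eventually_elim (use assms in \<open>auto intro!: divide_right_mono\<close>)
  qed
  ultimately show ?thesis by (simp add: prob_space)
qed

lemma continuous_on_exp_integral: "continuous_on {0..} (\<lambda>t. \<integral>\<mu>. exp (- t / \<mu>) \<partial>F)"
proof (rule lipschitz_on_continuous_on)
  show "1-lipschitz_on {0..} (\<lambda>t. \<integral>\<mu>. exp (- t / \<mu>) \<partial>F)"
  proof (rule lipschitz_onI)
    fix s t :: real assume "s \<in> {0..}" "t \<in> {0..}"
    then show "dist (\<integral>\<mu>. exp (- s / \<mu>) \<partial>F) (\<integral>\<mu>. exp (- t / \<mu>) \<partial>F) \<le> 1 * dist s t"
      using exp_integral_lipschitz[of s t] exp_integral_lipschitz[of t s]
      by (cases "s \<le> t") (auto simp: dist_real_def abs_minus_commute)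
  qed simp
qed

lemma ideal_risk_eq_0:
  assumes "AE \<mu> in F. \<mu> = 1" "Tq q (mixcdf F) = \<infinity>"
  shows "ideal_risk q F = 0"
proof -
  have "ideal_risk q F = (\<integral>\<^sup>+ \<mu>. 0 \<partial>F)"
    unfolding ideal_risk_def
  proof (rule nn_integral_cong_AE)
    show "AE \<mu> in F. (\<integral>\<^sup>+ x. ennreal (indicator {0..} x * (exp (- x / \<mu>) / \<mu>)
         * (ln (delta (Tq q (mixcdf F)) x) - ln \<mu>)\<^sup>2) \<partial>lborel) = 0"
      using assms(1) by eventually_elim (simp add: assms(2) delta_def)
  qed
  then show ?thesis by simp
qed

text \<open>Either no \<open>t\<close> meets the threshold condition, which forces the point mass at
  1 and zero risk, or the infimum is attained. In the latter case the condition fails at 0, because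
  \<open>1 < 1 / q\<close>, so by continuity it holds with equality at the infimum.\<close>

lemma Tq_cases:
  assumes q: "0 < q" "q < 1"
  obtains "\<And>t. 0 \<le> t \<Longrightarrow> (\<integral>\<mu>. exp (- t / \<mu>) \<partial>F) < exp (- t) / q" "ideal_risk q F = 0"
  | T where "0 < T" "Tq q (mixcdf F) = ereal T" "(\<integral>\<mu>. exp (- T / \<mu>) \<partial>F) = exp (- T) / q"
proof -
  define k where "k t = (\<integral>\<mu>. exp (- t / \<mu>) \<partial>F)" for t
  define S where "S = {t. 0 \<le> t \<and> exp (- t) / q \<le> k t}"
  have k0: "k 0 = 1" by (simp add: k_def prob_space)
  \<comment> \<open>No negative \<open>t\<close> qualifies: both cdfs vanish there and the condition
    would read \<open>1 >= 1 / q\<close>.\<close>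
  have "t \<in> S \<longleftrightarrow> 1 - mixcdf F t \<ge> (1 / q) * (1 - Ecdf t)" for t
    using q mixcdf_neg[of t] one_minus_mixcdf[of t]
    by (cases "t < 0") (auto simp: S_def k_def Ecdf_def)
  then have Tq: "Tq q (mixcdf F) = Inf (ereal ` S)"
    unfolding Tq_def by (intro arg_cong[where f=Inf]) auto
  show thesis
  proof (cases "S = {}")
    case True
    then have lt: "k t < exp (- t) / q" if "0 \<le> t" for t
      using that by (force simp: S_def)
    have Tinf: "Tq q (mixcdf F) = \<infinity>" using True by (simp add: Tq top_ereal_def)
    have int: "integrable F (\<lambda>\<mu>. 1 - 1 / \<mu>)"
      by (rule integrable_const_bound[where B=1], use AE_ge_1 in eventually_elim) (auto)
    have nn: "AE \<mu> in F. 0 \<le> 1 - 1 / \<mu>"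
      using AE_ge_1 by eventually_elim simp
    \<comment> \<open>By \<open>exp z >= z\<close> at \<open>z = t * (1 - 1 / \<mu>)\<close>, the
      product \<open>exp t * k t\<close> grows at least linearly in \<open>t\<close>, while
      emptiness of \<open>S\<close> caps it by \<open>1 / q\<close>. Hence the slope must be
      0.\<close>
    have bound: "t * (\<integral>\<mu>. 1 - 1 / \<mu> \<partial>F) \<le> 1 / q" if "0 \<le> t" for t
    proof -
      have "(\<integral>\<mu>. t * (1 - 1 / \<mu>) \<partial>F) \<le> (\<integral>\<mu>. exp t * exp (- t / \<mu>) \<partial>F)"
      proof (rule integral_mono)
        show "integrable F (\<lambda>\<mu>. t * (1 - 1 / \<mu>))" using int by (rule integrable_mult_right)
        show "integrable F (\<lambda>\<mu>. exp t * exp (- t / \<mu>))"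
          using integrable_exp[OF that] by (rule integrable_mult_right)
        show "t * (1 - 1 / \<mu>) \<le> exp t * exp (- t / \<mu>)" for \<mu>
          using exp_ge_add_one_self[of "t * (1 - 1 / \<mu>)"]
          by (simp add: exp_add[symmetric] algebra_simps)
      qed
      also have "\<dots> = exp t * k t" by (simp add: k_def)
      also have "\<dots> \<le> exp t * (exp (- t) / q)" using lt[OF that] by (intro mult_left_mono) auto
      also have "\<dots> = 1 / q" by (simp add: exp_minus)
      finally show ?thesis by simp
    qed
    have "(\<integral>\<mu>. 1 - 1 / \<mu> \<partial>F) = 0"
    proof (rule ccontr)
      define I where "I = (\<integral>\<mu>. 1 - 1 / \<mu> \<partial>F)"
      assume "(\<integral>\<mu>. 1 - 1 / \<mu> \<partial>F) \<noteq> 0"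
      then have "0 < I" using integral_nonneg_AE[OF nn] by (simp add: I_def)
      \<comment> \<open>At \<open>t = 2 / (q * I)\<close> the linear lower bound equals
        \<open>2 / q\<close>, twice the cap.\<close>
      then have "2 / q / I * I \<le> 1 / q"
        using bound[of "2 / q / I"] q by (simp add: I_def)
      with \<open>0 < I\<close> q show False by (simp add: field_simps)
    qed
    then have "AE \<mu> in F. 1 - 1 / \<mu> = 0"
      using integral_nonneg_eq_0_iff_AE[OF int nn] by simp
    then have "AE \<mu> in F. \<mu> = 1"
      using AE_ge_1 by eventually_elim (simp add: field_simps)
    then show thesis using that(1) lt ideal_risk_eq_0 Tinf unfolding k_def by blast
  next
    case False
    have cont: "continuous_on {0..} (\<lambda>t. k t - exp (- t) / q)"
      unfolding k_def by (intro continuous_intros continuous_on_exp_integral) (use q in auto)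
    have "closed ({0..} \<inter> (\<lambda>t. k t - exp (- t) / q) -` {0..})"
      using cont by (intro continuous_closed_preimage) auto
    also have "{0..} \<inter> (\<lambda>t. k t - exp (- t) / q) -` {0..} = S"
      by (auto simp: S_def)
    finally have "closed S" .
    moreover have bdd: "bdd_below S" by (auto simp: S_def intro: bdd_belowI[of _ 0])
    ultimately have TS: "Inf S \<in> S" using False by (intro closed_contains_Inf)
    define T where "T = Inf S"
    have T: "T \<in> S" "\<And>t. t \<in> S \<Longrightarrow> T \<le> t"
      using TS cInf_lower[OF _ bdd] by (auto simp: T_def)
    have "T \<noteq> 0" using T(1) q k0 by (auto simp: S_def)
    then have T0: "0 < T" using T(1) by (simp add: S_def)
    \<comment> \<open>The zero found in \<open>[0, T]\<close> lies in \<open>S\<close>, so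
      minimality of \<open>T\<close> identifies it with \<open>T\<close>.\<close>
    have "\<exists>t\<ge>0. t \<le> T \<and> k t - exp (- t) / q = 0"
      using T(1) T0 k0 q
      by (intro IVT' continuous_on_subset[OF cont]) (auto simp: S_def)
    then obtain t where t: "0 \<le> t" "t \<le> T" "k t = exp (- t) / q" by auto
    then have "t \<in> S" by (simp add: S_def)
    then have "t = T" using T(2) t(2) by force
    moreover have "Inf (ereal ` S) = ereal T"
      using T by (intro antisym Inf_lower Inf_greatest) auto
    ultimately show thesis using that(2)[of T] T0 t Tq unfolding k_def by simp
  qed
qed

lemma ideal_risk_eq:
  assumes "0 < T" "Tq q (mixcdf F) = ereal T"
  shows "ideal_risk q F = (\<integral>\<^sup>+ \<mu>. ennreal (cell_risk T \<mu>) \<partial>F)"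
  unfolding ideal_risk_def assms(2)
proof (rule nn_integral_cong_AE)
  show "AE \<mu> in F. (\<integral>\<^sup>+ x. ennreal (indicator {0..} x * (exp (- x / \<mu>) / \<mu>)
         * (ln (delta (ereal T) x) - ln \<mu>)\<^sup>2) \<partial>lborel) = ennreal (cell_risk T \<mu>)"
    using AE_ge_1 by eventually_elim (rule nn_integral_cell_risk[OF assms(1)])
qed

end

lemma mixing_Fclass: "F \<in> Fclass p \<eta> \<Longrightarrow> mixing F"
  by (auto simp: Fclass_def mixing_def mixing_axioms_def)

lemma borel_measurable_log_sq_tail [measurable]: "log_sq_tail \<in> borel_measurable borel"
proof -
  have "log_sq_tail = (\<lambda>a. enn2real (\<integral>\<^sup>+ y. ennreal (exp (- y) * (ln y)\<^sup>2)
      * (if a \<le> y then 1 else 0) \<partial>lborel))"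
    by (auto simp: log_sq_tail_def indicator_def intro!: ext arg_cong[where f=enn2real] nn_integral_cong)
  also have "\<dots> \<in> borel_measurable borel" by measurable
  finally show ?thesis .
qed

lemma borel_measurable_cell_risk [measurable]: "cell_risk T \<in> borel_measurable borel"
  unfolding cell_risk_def by measurable

section \<open>Pointwise bounds on the cell risk\<close>

lemma one_minus_inverse_le_ln:
  fixes \<mu> :: real
  assumes "1 \<le> \<mu>"
  shows "1 - 1 / \<mu> \<le> ln \<mu>"
  using ln_le_minus_one[of "1 / \<mu>"] assms by (simp add: ln_div)

text \<open>Used with \<open>x = 1 - 1 / \<mu>\<close> and \<open>y = ln \<mu>\<close>: because
  \<open>p < 2\<close>, a squared distance of the mean from 1 is paid for by the moment
  \<open>ln \<mu> powr p\<close>.\<close>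

lemma power2_le_powr:
  fixes x y p :: real
  assumes "0 \<le> x" "x \<le> 1" "x \<le> y" "0 < p" "p < 2"
  shows "x\<^sup>2 \<le> y powr p"
proof (cases "x = 0")
  case False
  then have "x\<^sup>2 = x powr 2" using assms by simp
  also have "\<dots> \<le> x powr p" using assms False by (intro powr_mono') auto
  also have "\<dots> \<le> y powr p" using assms by (intro powr_mono2) auto
  finally show ?thesis .
qed simp

text \<open>The exponent is at most \<open>1 / T <= 1 / 2\<close>, where
  \<open>exp z <= 1 + 2 * z\<close>. Means this close to 1 are thus indistinguishable from 1 at
  threshold \<open>T\<close>, up to a factor \<open>1 + 2 / T\<close>.\<close>

lemma exp_le_near_one:
  fixes T \<mu> :: real
  assumes "2 \<le> T" "1 \<le> \<mu>" "1 - 1 / \<mu> \<le> 1 / T\<^sup>2"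
  shows "exp (T * (1 - 1 / \<mu>)) \<le> 1 + 2 / T"
proof -
  have "T * (1 - 1 / \<mu>) \<le> T * (1 / T\<^sup>2)" using assms by (intro mult_left_mono) auto
  then have le: "T * (1 - 1 / \<mu>) \<le> 1 / T" using assms by (simp add: power2_eq_square)
  moreover have "1 / T \<le> 1 / 2" using assms by (intro divide_left_mono) auto
  ultimately have "T * (1 - 1 / \<mu>) \<le> 1 / 2" by linarith
  moreover have "0 \<le> T * (1 - 1 / \<mu>)" using assms by simp
  ultimately have "exp (T * (1 - 1 / \<mu>)) \<le> 1 + 2 * (T * (1 - 1 / \<mu>))"
    using exp_bound_lemma[of "T * (1 - 1 / \<mu>)"] by simp
  also have "\<dots> \<le> 1 + 2 / T" using le by simp
  finally show ?thesis .
qed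

lemma exp_minus_div_eq:
  fixes T \<mu> :: real
  shows "exp (- T / \<mu>) = exp (- T) * exp (T * (1 - 1 / \<mu>))"
  by (simp add: exp_add[symmetric] algebra_simps)

text \<open>The additive \<open>2 / T\<close> is needed for \<open>p > 1\<close>: as \<open>\<mu>\<close> tends to 1 the left-hand side is linear in
  \<open>ln \<mu>\<close> and hence not \<open>O(ln^p \<mu>)\<close>.\<close>

lemma exp_minus_1_le:
  fixes p :: real
  assumes p: "0 < p" "p < 2"
  shows "\<forall>\<^sub>F T in at_top. \<forall>\<mu>\<ge>1. exp (T * (1 - 1 / \<mu>)) - 1 \<le> 2 / T + 4 * exp T * ln \<mu> powr p"
proof -
  have "\<forall>\<^sub>F T::real in at_top. exp (T / 2) * T ^ 4 \<le> exp T" by real_asymp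
  then show ?thesis using eventually_ge_at_top[of 2]
  proof eventually_elim
    case (elim T)
    show ?case
    proof (intro allI impI)
      fix \<mu> :: real assume \<mu>: "1 \<le> \<mu>"
      define x where "x = 1 - 1 / \<mu>"
      have x: "0 \<le> x" "x < 1" "x \<le> ln \<mu>"
        using \<mu> one_minus_inverse_le_ln[OF \<mu>] by (auto simp: x_def)
      have xp: "x\<^sup>2 \<le> ln \<mu> powr p" using x p by (intro power2_le_powr) auto
      \<comment> \<open>Very near 1 the term \<open>2 / T\<close> suffices. In the middle range
        \<open>x^2\<close> exceeds \<open>T^(-4)\<close>, which the spare factor
        \<open>exp (T / 2)\<close> outweighs. For \<open>x > 1/2\<close> one has
        \<open>4 * x^2 >= 1\<close>.\<close>
      consider "x \<le> 1 / T\<^sup>2" | "1 / T\<^sup>2 < x" "x \<le> 1 / 2" | "1 / 2 < x" by linarith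
      then have "exp (T * x) - 1 \<le> 2 / T + 4 * exp T * ln \<mu> powr p"
      proof cases
        case 1
        have "exp (T * x) \<le> 1 + 2 / T"
          using 1 elim \<mu> unfolding x_def by (intro exp_le_near_one) auto
        then show ?thesis by (simp add: add_increasing2)
      next
        case 2
        have "exp (T * x) \<le> exp (T / 2)" using 2 elim by simp
        also have "\<dots> \<le> exp T * (1 / T\<^sup>2)\<^sup>2"
          using elim by (simp add: field_simps power2_eq_square power4_eq_xxxx)
        also have "\<dots> \<le> exp T * x\<^sup>2" using 2 by (intro mult_left_mono power_mono) auto
        also have "\<dots> \<le> exp T * ln \<mu> powr p" using xp by simp
        also have "\<dots> \<le> 4 * exp T * ln \<mu> powr p" by simp
        finally have "exp (T * x) \<le> 4 * exp T * ln \<mu> powr p" .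
        moreover have "0 \<le> 2 / T" using elim by simp
        ultimately show ?thesis by linarith
      next
        case 3
        have "exp (T * x) \<le> exp T" using x elim mult_left_mono[of x 1 T] by simp
        also have "\<dots> \<le> 4 * exp T * x\<^sup>2"
          using power_mono[of "1/2" x 2] 3 by (simp add: power2_eq_square)
        also have "\<dots> \<le> 4 * exp T * ln \<mu> powr p" using xp by simp
        finally have "exp (T * x) \<le> 4 * exp T * ln \<mu> powr p" .
        moreover have "0 \<le> 2 / T" using elim by simp
        ultimately show ?thesis by linarith
      qed
      then show "exp (T * (1 - 1 / \<mu>)) - 1 \<le> 2 / T + 4 * exp T * ln \<mu> powr p"
        by (simp add: x_def)
    qed
  qed
qed

section \<open>Crude bounds on the cell risk\<close>

lemma cell_risk_le:
  assumes "1 \<le> T" "1 \<le> \<mu>"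
  shows "cell_risk T \<mu> \<le> (ln \<mu>)\<^sup>2 + exp (- T / \<mu>) * tail_factor T"
proof -
  have "(1 - exp (- T / \<mu>)) * (ln \<mu>)\<^sup>2 \<le> 1 * (ln \<mu>)\<^sup>2"
    using assms by (intro mult_right_mono) auto
  moreover have "log_sq_tail (T / \<mu>) \<le> exp (- (T / \<mu>)) * tail_factor T"
    using assms mult_left_mono[of 1 \<mu> T] by (intro log_sq_tail_le) (auto simp: field_simps)
  ultimately show ?thesis by (simp add: cell_risk_def)
qed

text \<open>A bound uniform in the mean: the chance of falling below \<open>T\<close> is at most
  \<open>T / \<mu>\<close>, which beats the growth \<open>(ln \<mu>)^2 <= 4 * \<mu>\<close>. It
  serves when the threshold is much larger than \<open>ln (1 / \<eta>)\<close>.\<close>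

lemma cell_risk_le_linear:
  assumes "0 \<le> T" "1 \<le> \<mu>"
  shows "cell_risk T \<mu> \<le> 4 * T + log_sq_tail 0"
proof -
  have "(1 - exp (- T / \<mu>)) * (ln \<mu>)\<^sup>2 \<le> (T / \<mu>) * (4 * \<mu>)"
  proof (rule mult_mono)
    show "1 - exp (- T / \<mu>) \<le> T / \<mu>" using exp_ge_add_one_self[of "- T / \<mu>"] by simp
    have "ln (sqrt \<mu>) \<le> sqrt \<mu>" using ln_le_minus_one[of "sqrt \<mu>"] assms by simp
    then have "ln \<mu> \<le> 2 * sqrt \<mu>" using assms by (simp add: ln_sqrt)
    then have "(ln \<mu>)\<^sup>2 \<le> (2 * sqrt \<mu>)\<^sup>2" using assms by (intro power_mono) auto
    then show "(ln \<mu>)\<^sup>2 \<le> 4 * \<mu>" using assms by (simp add: power_mult_distrib)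
  qed (use assms in auto)
  moreover have "log_sq_tail (T / \<mu>) \<le> log_sq_tail 0"
    using assms by (intro log_sq_tail_antimono) auto
  ultimately show ?thesis using assms by (simp add: cell_risk_def)
qed

lemma ln_sq_le_powr:
  fixes \<mu> p :: real
  assumes "1 \<le> \<mu>" "\<mu> \<le> 4" "0 < p" "p < 2"
  shows "(ln \<mu>)\<^sup>2 \<le> 9 * ln \<mu> powr p"
proof (cases "\<mu> = 1")
  case False
  then have l: "0 < ln \<mu>" "ln \<mu> \<le> 3" using assms ln_le_minus_one[of \<mu>] by auto
  have "(ln \<mu>)\<^sup>2 = ln \<mu> powr (2 - p) * ln \<mu> powr p"
    using l by (simp add: powr_add[symmetric])
  also have "\<dots> \<le> 9 * ln \<mu> powr p"
  proof (rule mult_right_mono)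
    have "ln \<mu> powr (2 - p) \<le> 3 powr (2 - p)" using l assms by (intro powr_mono2) auto
    also have "\<dots> \<le> 3 powr 2" using assms by (intro powr_mono) auto
    finally show "ln \<mu> powr (2 - p) \<le> 9" by simp
  qed simp
  finally show ?thesis .
qed simp

text \<open>Means up to 4 cost a constant multiple of \<open>ln \<mu> powr p\<close>, with no
  growing factor, apart from a term in \<open>exp (- T)\<close> shared by all of them. If
  \<open>x <= 1 / T^2\<close>, then \<open>exp (- T / \<mu>)\<close> is \<open>exp (- T)\<close> up
  to a factor \<open>1 + 2 / T\<close>; otherwise it is at most \<open>exp (- T / 4)\<close>, which
  even times \<open>tail_factor T\<close> is below \<open>T^(-4) <= x^2\<close>. The constant 10 is
  9 for the bias plus 1 for this second case.\<close>

lemma cell_risk_small_mean: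
  fixes p \<gamma> \<delta> :: real
  assumes p: "0 < p" "p < 2" and "0 \<le> \<gamma>" "0 < \<delta>"
  shows "\<forall>\<^sub>F T in at_top. \<forall>\<mu>. 1 \<le> \<mu> \<longrightarrow> \<mu> \<le> 4 \<longrightarrow>
     cell_risk T \<mu> + \<gamma> * tail_factor T * (exp (- T / \<mu>) - exp (- T))
       \<le> 10 * ln \<mu> powr p + (tail_factor T + \<delta>) * exp (- T)"
proof -
  have "((\<lambda>T. (1 + \<gamma>) * tail_factor T * (2 / T)) \<longlongrightarrow> 0) at_top"
    unfolding tail_factor_def by real_asymp
  then have "\<forall>\<^sub>F T in at_top. (1 + \<gamma>) * tail_factor T * (2 / T) < \<delta>"
    using assms by (intro order_tendstoD) auto
  moreover have "((\<lambda>T. (1 + \<gamma>) * tail_factor T * exp (- T / 4) * T ^ 4) \<longlongrightarrow> 0) at_top"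
    unfolding tail_factor_def by real_asymp
  then have "\<forall>\<^sub>F T in at_top. (1 + \<gamma>) * tail_factor T * exp (- T / 4) * T ^ 4 < 1"
    by (intro order_tendstoD) auto
  ultimately show ?thesis using eventually_ge_at_top[of 2]
  proof eventually_elim
    case (elim T)
    show ?case
    proof (intro allI impI)
      fix \<mu> :: real assume \<mu>: "1 \<le> \<mu>" "\<mu> \<le> 4"
      define W where "W = tail_factor T"
      define x where "x = 1 - 1 / \<mu>"
      define e where "e = exp (- T / \<mu>)"
      have W: "1 \<le> W" using tail_factor_ge_1 by (simp add: W_def)
      have x: "0 \<le> x" "x < 1" "x \<le> ln \<mu>"
        using \<mu> one_minus_inverse_le_ln[OF \<mu>(1)] by (auto simp: x_def)
      have c: "cell_risk T \<mu> \<le> 9 * ln \<mu> powr p + e * W"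
        using cell_risk_le[of T \<mu>] ln_sq_le_powr[OF \<mu> p] \<mu> elim by (simp add: W_def e_def)
      have "cell_risk T \<mu> + \<gamma> * W * (e - exp (- T)) \<le> 10 * ln \<mu> powr p + (W + \<delta>) * exp (- T)"
      proof (cases "x \<le> 1 / T\<^sup>2")
        case True
        have "e \<le> exp (- T) * (1 + 2 / T)"
          unfolding e_def exp_minus_div_eq using True elim \<mu>
          by (intro mult_left_mono exp_le_near_one) (auto simp: x_def)
        then have "(1 + \<gamma>) * W * e \<le> (1 + \<gamma>) * W * (exp (- T) * (1 + 2 / T))"
          using W assms by (intro mult_left_mono) auto
        moreover have "((1 + \<gamma>) * W * (2 / T)) * exp (- T) \<le> \<delta> * exp (- T)"
          using elim by (intro mult_right_mono) (auto simp: W_def)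
        moreover have "cell_risk T \<mu> \<le> 10 * ln \<mu> powr p + e * W"
          using c powr_ge_zero[of "ln \<mu>" p] by linarith
        ultimately show ?thesis by (simp add: algebra_simps)
      next
        case False
        have "1 / 4 \<le> 1 / \<mu>" using \<mu> by (intro divide_left_mono) auto
        then have "T * (1 / 4) \<le> T * (1 / \<mu>)" using elim by (intro mult_left_mono) auto
        then have "e \<le> exp (- T / 4)" by (simp add: e_def)
        then have "(1 + \<gamma>) * W * e \<le> (1 + \<gamma>) * W * exp (- T / 4)"
          using W assms by (intro mult_left_mono) auto
        also have "\<dots> \<le> (1 / T\<^sup>2)\<^sup>2"
          using elim by (simp add: W_def field_simps power2_eq_square power4_eq_xxxx)
        also have "\<dots> \<le> x\<^sup>2" using False by (intro power_mono) auto
        also have "\<dots> \<le> ln \<mu> powr p" using x p by (intro power2_le_powr) auto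
        finally have "(1 + \<gamma>) * W * e \<le> ln \<mu> powr p" .
        moreover have "0 \<le> \<gamma> * W * exp (- T)" "0 \<le> (W + \<delta>) * exp (- T)"
          using W assms by auto
        ultimately show ?thesis using c by (simp add: algebra_simps)
      qed
      then show "cell_risk T \<mu> + \<gamma> * tail_factor T * (exp (- T / \<mu>) - exp (- T))
          \<le> 10 * ln \<mu> powr p + (tail_factor T + \<delta>) * exp (- T)"
        by (simp add: W_def e_def)
    qed
  qed
qed

section \<open>Means bounded away from 1\<close>

lemma ln_4_ge_1: "1 \<le> ln (4::real)"
proof -
  have "exp 1 \<le> (4::real)" using e_less_272 by simp
  then show ?thesis by (simp add: ln_ge_iff)
qed

text \<open>On the log scale, \<open>l = ln \<mu>\<close> is compared with \<open>M = ln T\<close>.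
  Well below \<open>M\<close> the bias dominates and \<open>l^2 <= N\<close>; well above it the
  variance term dominates. In between, bias and variance carry the weights
  \<open>1 - exp (- a)\<close> and \<open>exp (- a)\<close>, so their sum is at most the larger of
  the two costs.\<close>

lemma cell_risk_large_mean_aux:
  fixes p \<gamma> \<kappa> :: real
  assumes p: "0 < p" "p < 2" and \<gamma>: "0 \<le> \<gamma>" and \<kappa>: "0 < \<kappa>" "\<kappa> < 1"
  shows "\<forall>\<^sub>F T in at_top. \<forall>\<mu>\<ge>4. cell_risk T \<mu> + \<gamma> * tail_factor T * exp (- T / \<mu>)
     \<le> (2 * \<kappa> + max 1 \<gamma> * ((1 + \<kappa>) / (1 - \<kappa>))\<^sup>2) * (ln T powr (2 - p) * ln \<mu> powr p)"
proof -
  have "((\<lambda>T. tail_factor T / (ln T)\<^sup>2) \<longlongrightarrow> 1) at_top"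
    unfolding tail_factor_def by real_asymp
  then have ev1: "\<forall>\<^sub>F T in at_top. tail_factor T / (ln T)\<^sup>2 < 1 + \<kappa>"
    using \<kappa> by (intro order_tendstoD) auto
  have "((\<lambda>T. (1 + \<gamma>) * tail_factor T * exp (- (T powr \<kappa>))) \<longlongrightarrow> 0) at_top"
    unfolding tail_factor_def using \<kappa> by real_asymp
  then have ev2: "\<forall>\<^sub>F T in at_top. (1 + \<gamma>) * tail_factor T * exp (- (T powr \<kappa>)) < \<kappa>"
    using \<kappa> by (intro order_tendstoD) auto
  have "filterlim (\<lambda>T. \<kappa> * ln T powr (2 - p)) at_top at_top"
    using \<kappa> p by real_asymp
  then have ev3: "\<forall>\<^sub>F T in at_top. log_sq_tail 0 \<le> \<kappa> * ln T powr (2 - p)"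
    by (simp add: filterlim_at_top)
  \<comment> \<open>If \<open>l > (1 + \<kappa>) * M\<close> then
    \<open>M - l < - \<beta> * l\<close>, so \<open>T / \<mu>\<close> is at most
    \<open>exp (- \<beta> * l)\<close>.\<close>
  define \<beta> where "\<beta> = \<kappa> / (1 + \<kappa>)"
  have \<beta>: "0 < \<beta>" using \<kappa> by (simp add: \<beta>_def)
  have "((\<lambda>l. exp (- \<beta> * l) * l\<^sup>2) \<longlongrightarrow> 0) at_top" using \<beta> by real_asymp
  then have "\<forall>\<^sub>F l in at_top. exp (- \<beta> * l) * l\<^sup>2 < \<kappa>"
    using \<kappa> by (intro order_tendstoD) auto
  then obtain l0 where l0: "\<And>l. l0 \<le> l \<Longrightarrow> exp (- \<beta> * l) * l\<^sup>2 < \<kappa>"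
    by (auto simp: eventually_at_top_linorder)
  have "filterlim (ln :: real \<Rightarrow> real) at_top at_top" by real_asymp
  then have ev4: "\<forall>\<^sub>F T in at_top. max 1 l0 \<le> ln (T::real)"
    unfolding filterlim_at_top by blast
  from ev1 ev2 ev3 ev4 eventually_ge_at_top[of 1] show ?thesis
  proof eventually_elim
    case (elim T)
    show ?case
    proof (intro allI impI)
      fix \<mu> :: real assume \<mu>: "4 \<le> \<mu>"
      define W where "W = tail_factor T"
      define M where "M = ln T"
      define l where "l = ln \<mu>"
      define a where "a = T / \<mu>"
      define N where "N = M powr (2 - p) * l powr p"
      define \<rho> where "\<rho> = ((1 + \<kappa>) / (1 - \<kappa>))\<^sup>2"
      have M: "1 \<le> M" "l0 \<le> M" using elim by (auto simp: M_def)
      have T0: "0 < T" using elim by simp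
      have W: "1 \<le> W" "W \<le> (1 + \<kappa>) * M\<^sup>2"
        using elim(1) M tail_factor_ge_1 by (auto simp: W_def M_def pos_divide_less_eq)
      have l1: "1 \<le> l" using ln_4_ge_1 \<mu> unfolding l_def
        by (meson ln_le_cancel_iff order_trans zero_less_numeral less_le_trans)
      have a: "0 < a" "a \<le> T" using T0 \<mu> by (auto simp: a_def field_simps mult_left_mono)
      have a_eq: "a = exp (M - l)" using T0 \<mu> by (simp add: a_def M_def l_def exp_diff)
      have "1 * 1 \<le> M powr (2 - p) * l powr p"
        using M l1 p by (intro mult_mono) (auto intro!: ge_one_powr_ge_zero)
      then have N1: "1 \<le> N" by (simp add: N_def)
      have l2: "l\<^sup>2 = l powr (2 - p) * l powr p" using l1 by (simp add: powr_add[symmetric])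
      have M2: "M\<^sup>2 = M powr (2 - p) * M powr p" using M by (simp add: powr_add[symmetric])
      have \<rho>1: "1 \<le> \<rho>" unfolding \<rho>_def using \<kappa> by (intro one_le_power) (auto simp: field_simps)
      have \<rho>2: "(1 + \<kappa>)\<^sup>2 \<le> \<rho>"
        unfolding \<rho>_def power_divide using \<kappa>
        by (auto simp: le_divide_eq power_le_one intro!: mult_left_le)
      have c1: "1 \<le> max 1 \<gamma>" by simp
      have ea: "0 < exp (- a)" "exp (- a) \<le> 1" using a by auto
      have vt: "log_sq_tail a \<le> exp (- a) * W"
        using log_sq_tail_le[of T a] a elim by (simp add: W_def)
      \<comment> \<open>The estimation error in the cell is at most the constant
        \<open>log_sq_tail 0\<close>, whereas \<open>N\<close> grows with \<open>M\<close>; this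
        accounts for one of the two \<kappa>.\<close>
      have v0: "log_sq_tail a \<le> \<kappa> * N"
      proof -
        have "log_sq_tail a \<le> log_sq_tail 0" using a by (intro log_sq_tail_antimono) auto
        also have "\<dots> \<le> \<kappa> * (M powr (2 - p) * 1)" using elim by (simp add: M_def)
        also have "\<dots> \<le> \<kappa> * N" unfolding N_def using \<kappa> l1 p
          by (intro mult_left_mono) (auto intro!: ge_one_powr_ge_zero)
        finally show ?thesis .
      qed
      have main: "(1 - exp (- a)) * l\<^sup>2 + log_sq_tail a + \<gamma> * W * exp (- a)
          \<le> (2 * \<kappa> + max 1 \<gamma> * \<rho>) * N"
      \<comment> \<open>Below \<open>(1 - \<kappa>) * M\<close> the ratio \<open>T / \<mu>\<close>
        is at least \<open>T powr \<kappa>\<close>, which annihilates every term carrying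
        \<open>exp (- a)\<close>.\<close>
      proof (cases "l \<le> (1 - \<kappa>) * M")
        case True
        have "l \<le> M" using True \<kappa> M by (simp add: left_diff_distrib) (smt (verit) mult_nonneg_nonneg)
        then have "l powr (2 - p) \<le> M powr (2 - p)" using l1 p by (intro powr_mono2) auto
        then have "l\<^sup>2 \<le> N" unfolding l2 N_def by (intro mult_right_mono) auto
        moreover have "(1 - exp (- a)) * l\<^sup>2 \<le> 1 * l\<^sup>2"
          using ea by (intro mult_right_mono) auto
        ultimately have 1: "(1 - exp (- a)) * l\<^sup>2 \<le> N" by simp
        have "T powr \<kappa> = exp (\<kappa> * M)" using T0 by (simp add: powr_def M_def)
        also have "\<dots> \<le> a" unfolding a_eq using True by (simp add: algebra_simps)
        finally have "(1 + \<gamma>) * W * exp (- a) \<le> (1 + \<gamma>) * W * exp (- (T powr \<kappa>))"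
          using \<gamma> W by (intro mult_left_mono) auto
        then have "(1 + \<gamma>) * W * exp (- a) \<le> \<kappa>" using elim by (simp add: W_def)
        also have "\<kappa> \<le> \<kappa> * N" using \<kappa> N1 by simp
        finally have 2: "log_sq_tail a + \<gamma> * W * exp (- a) \<le> \<kappa> * N"
          using vt by (simp add: algebra_simps)
        have "1 * N \<le> (max 1 \<gamma> * \<rho>) * N"
          using \<rho>1 c1 N1 mult_mono[of 1 "max 1 \<gamma>" 1 \<rho>] by (intro mult_right_mono) auto
        moreover have "0 \<le> \<kappa> * N" using \<kappa> N1 by simp
        ultimately show ?thesis using 1 2 by (simp add: distrib_right)
      next
        case False
        have "M powr p \<le> (l / (1 - \<kappa>)) powr p"
          using False \<kappa> M p by (intro powr_mono2) (auto simp: field_simps)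
        also have "\<dots> = l powr p * (1 / (1 - \<kappa>)) powr p"
          using l1 \<kappa> by (subst powr_mult[symmetric]) auto
        also have "\<dots> \<le> l powr p * (1 / (1 - \<kappa>)) powr 2"
          using \<kappa> p by (intro mult_left_mono powr_mono) auto
        finally have "M powr p \<le> l powr p * (1 / (1 - \<kappa>))\<^sup>2"
          using \<kappa> by simp
        then have "M powr (2 - p) * M powr p \<le> M powr (2 - p) * (l powr p * (1 / (1 - \<kappa>))\<^sup>2)"
          by (intro mult_left_mono) auto
        then have "M\<^sup>2 \<le> N * (1 / (1 - \<kappa>))\<^sup>2" by (simp add: M2 N_def)
        then have "(1 + \<kappa>) * M\<^sup>2 \<le> (1 + \<kappa>)\<^sup>2 * (N * (1 / (1 - \<kappa>))\<^sup>2)"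
          using \<kappa> N1 by (intro mult_mono) (auto simp: power2_eq_square field_simps)
        also have "\<dots> = \<rho> * N" by (simp add: \<rho>_def power_divide)
        \<comment> \<open>As \<open>M\<close> exceeds \<open>l\<close> by at most a factor
          \<open>1 / (1 - \<kappa>)\<close>, \<open>M^2\<close> is comparable with \<open>N\<close>,
          and so is \<open>W\<close>.\<close>
        finally have WN: "W \<le> \<rho> * N" using W by simp
        have "\<gamma> * W \<le> max 1 \<gamma> * (\<rho> * N)" using WN W \<gamma> by (intro mult_mono) auto
        then have g: "\<gamma> * W * exp (- a) \<le> max 1 \<gamma> * (\<rho> * N) * exp (- a)"
          using ea by (intro mult_right_mono) auto
        have rn: "0 \<le> max 1 \<gamma> * (\<rho> * N)" using \<rho>1 N1 by simp
        show ?thesis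
        proof (cases "l \<le> (1 + \<kappa>) * M")
          case True
          have "l powr (2 - p) \<le> ((1 + \<kappa>) * M) powr (2 - p)"
            using True l1 p by (intro powr_mono2) auto
          also have "\<dots> = (1 + \<kappa>) powr (2 - p) * M powr (2 - p)"
            using \<kappa> M by (simp add: powr_mult)
          also have "\<dots> \<le> (1 + \<kappa>) powr 2 * M powr (2 - p)"
            using \<kappa> p by (intro mult_right_mono powr_mono) auto
          also have "\<dots> \<le> \<rho> * M powr (2 - p)"
            using \<kappa> \<rho>2 by (intro mult_right_mono) auto
          finally have "l\<^sup>2 \<le> \<rho> * N"
            unfolding l2 N_def by (simp add: mult.assoc[symmetric] mult_right_mono)
          also have "\<dots> \<le> max 1 \<gamma> * (\<rho> * N)"
            using mult_right_mono[OF c1, of "\<rho> * N"] \<rho>1 N1 by simp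
          \<comment> \<open>Both costs are now at most \<open>max 1 \<gamma> * (\<rho> * N)\<close>,
            and their weights add up to 1.\<close>
          finally have "(1 - exp (- a)) * l\<^sup>2 \<le> (1 - exp (- a)) * (max 1 \<gamma> * (\<rho> * N))"
            using ea by (intro mult_left_mono) auto
          also have "\<dots> = max 1 \<gamma> * (\<rho> * N) - max 1 \<gamma> * (\<rho> * N) * exp (- a)"
            by (simp add: algebra_simps)
          finally have "(1 - exp (- a)) * l\<^sup>2 + \<gamma> * W * exp (- a) \<le> max 1 \<gamma> * (\<rho> * N)"
            using g by linarith
          moreover have "0 \<le> \<kappa> * N" using \<kappa> N1 by simp
          ultimately show ?thesis using v0 by (simp add: algebra_simps)
        next
          case lM: False
          have "1 - exp (- a) \<le> a" using exp_ge_add_one_self[of "- a"] by simp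
          also have "a \<le> exp (- \<beta> * l)"
          proof -
            have "M \<le> l / (1 + \<kappa>)" using lM \<kappa> by (simp add: field_simps)
            moreover have "l / (1 + \<kappa>) - l = - \<beta> * l" using \<kappa> by (simp add: \<beta>_def field_simps)
            ultimately show ?thesis by (simp add: a_eq)
          qed
          finally have "(1 - exp (- a)) * l\<^sup>2 \<le> exp (- \<beta> * l) * l\<^sup>2"
            by (intro mult_right_mono) auto
          also have "\<dots> \<le> \<kappa>"
          proof -
            have "0 \<le> \<kappa> * M" using \<kappa> M by simp
            then have "l0 \<le> l" using lM M by (simp add: distrib_right)
            then show ?thesis using l0[of l] by simp
          qed
          also have "\<kappa> \<le> \<kappa> * N" using \<kappa> N1 by simp
          finally have "(1 - exp (- a)) * l\<^sup>2 \<le> \<kappa> * N" .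
          moreover have "max 1 \<gamma> * (\<rho> * N) * exp (- a) \<le> max 1 \<gamma> * (\<rho> * N)"
            using mult_left_mono[OF ea(2) rn] by simp
          ultimately have "(1 - exp (- a)) * l\<^sup>2 + \<gamma> * W * exp (- a) \<le> \<kappa> * N + max 1 \<gamma> * (\<rho> * N)"
            using g by linarith
          then show ?thesis using v0 by (simp add: algebra_simps)
        qed
      qed
      then show "cell_risk T \<mu> + \<gamma> * tail_factor T * exp (- T / \<mu>)
        \<le> (2 * \<kappa> + max 1 \<gamma> * ((1 + \<kappa>) / (1 - \<kappa>))\<^sup>2) * (ln T powr (2 - p) * ln \<mu> powr p)"
        by (simp add: cell_risk_def W_def M_def l_def a_def N_def \<rho>_def)
    qed
  qed
qed

text \<open>The constant of the preceding lemma tends to \<open>max 1 \<gamma>\<close> as \<kappa>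
  tends to 0, so a small fixed \<kappa> works.\<close>

lemma cell_risk_large_mean:
  fixes p \<gamma> \<delta> :: real
  assumes p: "0 < p" "p < 2" and \<gamma>: "0 \<le> \<gamma>" and \<delta>: "0 < \<delta>"
  shows "\<forall>\<^sub>F T in at_top. \<forall>\<mu>\<ge>4. cell_risk T \<mu> + \<gamma> * tail_factor T * exp (- T / \<mu>)
     \<le> (max 1 \<gamma> + \<delta>) * (ln T powr (2 - p) * ln \<mu> powr p)"
proof -
  have "((\<lambda>\<kappa>. 2 * \<kappa> + max 1 \<gamma> * ((1 + \<kappa>) / (1 - \<kappa>))\<^sup>2) \<longlongrightarrow> 2 * 0 + max 1 \<gamma> * ((1 + 0) / (1 - 0))\<^sup>2)
      (at_right 0)"
    by (intro tendsto_intros) auto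
  then have "\<forall>\<^sub>F \<kappa> in at_right 0. 2 * \<kappa> + max 1 \<gamma> * ((1 + \<kappa>) / (1 - \<kappa>))\<^sup>2 < max 1 \<gamma> + \<delta>"
    using \<delta> by (intro order_tendstoD) auto
  moreover have "\<forall>\<^sub>F \<kappa> in at_right (0::real). \<kappa> < 1" by real_asymp
  moreover have "\<forall>\<^sub>F \<kappa> in at_right (0::real). 0 < \<kappa>" by real_asymp
  ultimately have "\<forall>\<^sub>F \<kappa> in at_right 0. 2 * \<kappa> + max 1 \<gamma> * ((1 + \<kappa>) / (1 - \<kappa>))\<^sup>2 < max 1 \<gamma> + \<delta>
      \<and> \<kappa> < 1 \<and> 0 < \<kappa>" by eventually_elim simp
  then obtain \<kappa> where \<kappa>: "2 * \<kappa> + max 1 \<gamma> * ((1 + \<kappa>) / (1 - \<kappa>))\<^sup>2 < max 1 \<gamma> + \<delta>" "\<kappa> < 1" "0 < \<kappa>"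
    using eventually_happens[of _ "at_right (0::real)"] by auto
  from cell_risk_large_mean_aux[OF p \<gamma> \<kappa>(3,2)] show ?thesis
  proof eventually_elim
    case (elim T)
    show ?case
    proof (intro allI impI)
      fix \<mu> :: real assume "4 \<le> \<mu>"
      then have "cell_risk T \<mu> + \<gamma> * tail_factor T * exp (- T / \<mu>)
         \<le> (2 * \<kappa> + max 1 \<gamma> * ((1 + \<kappa>) / (1 - \<kappa>))\<^sup>2) * (ln T powr (2 - p) * ln \<mu> powr p)"
        using elim by blast
      also have "\<dots> \<le> (max 1 \<gamma> + \<delta>) * (ln T powr (2 - p) * ln \<mu> powr p)"
        using \<kappa> by (intro mult_right_mono) auto
      finally show "cell_risk T \<mu> + \<gamma> * tail_factor T * exp (- T / \<mu>)
         \<le> (max 1 \<gamma> + \<delta>) * (ln T powr (2 - p) * ln \<mu> powr p)" .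
    qed
  qed
qed

section \<open>Upper bound\<close>

context mixing begin

text \<open>\<open>D\<close> acts as a Lagrange multiplier: the threshold equation fixes the
  integral of \<open>exp (- T / \<mu>) - exp (- T)\<close> at
  \<open>(1 / q - 1) * exp (- T)\<close>, so multiples of it may be added to either side of a
  pointwise bound. Two nonnegative multipliers keep everything inside
  \<open>ennreal\<close>.\<close>

lemma ideal_risk_le:
  assumes q: "0 < q" "q < 1"
    and T: "0 < T" "Tq q (mixcdf F) = ereal T" "(\<integral>\<mu>. exp (- T / \<mu>) \<partial>F) = exp (- T) / q"
    and moment: "(\<integral>\<^sup>+ \<mu>. ennreal (ln \<mu> powr p) \<partial>F) \<le> ennreal h" "0 \<le> h"
    and nonneg: "0 \<le> A" "0 \<le> B" "0 \<le> D" "0 \<le> D'"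
    and le: "\<And>\<mu>. 1 \<le> \<mu> \<Longrightarrow> cell_risk T \<mu> + D * (exp (- T / \<mu>) - exp (- T))
       \<le> A * ln \<mu> powr p + B * exp (- T) + D' * (exp (- T / \<mu>) - exp (- T))"
  shows "ideal_risk q F \<le> ennreal (A * h + (B + (D' - D) * (1 / q - 1)) * exp (- T))"
proof -
  define g where "g \<mu> = exp (- T / \<mu>) - exp (- T)" for \<mu> :: real
  define K where "K = (1 / q - 1) * exp (- T)"
  have [measurable]: "g \<in> borel_measurable F" "cell_risk T \<in> borel_measurable F"
    unfolding g_def by measurable
  have K: "0 \<le> K" using q by (simp add: K_def)
  have g0: "0 \<le> g \<mu>" if "1 \<le> \<mu>" for \<mu>
    using that T mult_left_mono[of 1 \<mu> T] by (simp add: g_def field_simps)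
  have "AE \<mu> in F. 0 \<le> g \<mu>" using AE_ge_1 by eventually_elim (rule g0)
  moreover have "integrable F g" unfolding g_def using T
    by (intro Bochner_Integration.integrable_diff integrable_exp) auto
  moreover have "(\<integral>\<mu>. g \<mu> \<partial>F) = K"
    unfolding g_def using T integrable_exp[of T]
    by (subst Bochner_Integration.integral_diff) (auto simp: prob_space K_def field_simps)
  ultimately have G: "(\<integral>\<^sup>+ \<mu>. ennreal (g \<mu>) \<partial>F) = ennreal K"
    by (subst nn_integral_eq_integral) auto
  have "ideal_risk q F + ennreal (D * K)
      = (\<integral>\<^sup>+ \<mu>. ennreal (cell_risk T \<mu>) \<partial>F) + (\<integral>\<^sup>+ \<mu>. ennreal D * ennreal (g \<mu>) \<partial>F)"
    using nonneg K by (simp add: ideal_risk_eq[OF T(1,2)] nn_integral_cmult G ennreal_mult)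
  also have "\<dots> = (\<integral>\<^sup>+ \<mu>. ennreal (cell_risk T \<mu>) + ennreal D * ennreal (g \<mu>) \<partial>F)"
    by (rule nn_integral_add[symmetric]) measurable
  also have "\<dots> \<le> (\<integral>\<^sup>+ \<mu>. ennreal A * ennreal (ln \<mu> powr p) + ennreal (B * exp (- T))
      + ennreal D' * ennreal (g \<mu>) \<partial>F)"
  proof (rule nn_integral_mono_AE, use AE_ge_1 in eventually_elim)
    case (elim \<mu>)
    have "ennreal (cell_risk T \<mu>) + ennreal D * ennreal (g \<mu>) = ennreal (cell_risk T \<mu> + D * g \<mu>)"
      using nonneg g0[OF elim] cell_risk_nonneg[of T \<mu>] T elim by (simp add: ennreal_mult)
    also have "\<dots> \<le> ennreal (A * ln \<mu> powr p + B * exp (- T) + D' * g \<mu>)"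
      using le[OF elim] by (intro ennreal_leI) (simp add: g_def)
    also have "\<dots> = ennreal A * ennreal (ln \<mu> powr p) + ennreal (B * exp (- T)) + ennreal D' * ennreal (g \<mu>)"
      using nonneg g0[OF elim] by (simp add: ennreal_mult)
    finally show ?case .
  qed
  also have "\<dots> = ennreal A * (\<integral>\<^sup>+ \<mu>. ennreal (ln \<mu> powr p) \<partial>F) + ennreal (B * exp (- T))
      + ennreal D' * ennreal K"
    by (simp add: nn_integral_add nn_integral_cmult G emeasure_space_1)
  also have "\<dots> \<le> ennreal A * ennreal h + ennreal (B * exp (- T)) + ennreal D' * ennreal K"
    using moment by (intro add_mono mult_left_mono) auto
  also have "\<dots> = ennreal (A * h + B * exp (- T) + D' * K)"
    using nonneg K moment by (simp add: ennreal_mult)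
  finally have *: "ideal_risk q F + ennreal (D * K) \<le> ennreal (A * h + B * exp (- T) + D' * K)" .
  \<comment> \<open>The risk must be finite before \<open>D * K\<close> can be subtracted in the
    reals.\<close>
  then have "ideal_risk q F < \<top>"
    by (metis ennreal_add_eq_top ennreal_less_top neq_top_trans top.not_eq_extremum)
  then obtain r where r: "ideal_risk q F = ennreal r" "0 \<le> r"
    by (cases "ideal_risk q F") auto
  have "ennreal (r + D * K) \<le> ennreal (A * h + B * exp (- T) + D' * K)"
    using * r nonneg K by simp
  then have "r + D * K \<le> A * h + B * exp (- T) + D' * K"
    by (subst (asm) ennreal_le_iff) (use nonneg K moment in auto)
  then have "r \<le> A * h + (B + (D' - D) * (1 / q - 1)) * exp (- T)"
    by (simp add: K_def algebra_simps diff_divide_distrib)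
  then show ?thesis by (simp add: r ennreal_leI)
qed

text \<open>Multiplied by \<open>exp T\<close>, the threshold equation says that
  \<open>exp (T * (1 - 1 / \<mu>)) - 1\<close> has mean \<open>1 / q - 1\<close>. This integrand
  increases with \<open>T\<close>, so \<open>S\<close> may replace \<open>T\<close> before the
  moment bound is applied.\<close>

lemma threshold_bound:
  assumes q: "0 < q" "q < 1"
    and T: "0 < T" "(\<integral>\<mu>. exp (- T / \<mu>) \<partial>F) = exp (- T) / q"
    and moment: "(\<integral>\<^sup>+ \<mu>. ennreal (ln \<mu> powr p) \<partial>F) \<le> ennreal h" "0 \<le> h"
    and S: "T \<le> S"
    and le: "\<And>\<mu>. 1 \<le> \<mu> \<Longrightarrow> exp (S * (1 - 1 / \<mu>)) - 1 \<le> 2 / S + 4 * exp S * ln \<mu> powr p"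
  shows "1 / q - 1 \<le> 2 / S + 4 * exp S * h"
proof -
  have int: "integrable F (\<lambda>\<mu>. exp T * exp (- T / \<mu>) - 1)"
    using integrable_exp[of T] T by (intro Bochner_Integration.integrable_diff integrable_mult_right) auto
  have eq: "exp T * exp (- T / \<mu>) = exp (T * (1 - 1 / \<mu>))" for \<mu> :: real
    by (simp add: exp_add[symmetric] algebra_simps)
  have "AE \<mu> in F. 0 \<le> exp T * exp (- T / \<mu>) - 1"
    using AE_ge_1 unfolding eq by eventually_elim (use T(1) in simp)
  moreover have "(\<integral>\<mu>. exp T * exp (- T / \<mu>) - 1 \<partial>F) = 1 / q - 1"
    using integrable_exp[of T] T by (simp add: prob_space exp_minus)
  ultimately have "ennreal (1 / q - 1) = (\<integral>\<^sup>+ \<mu>. ennreal (exp T * exp (- T / \<mu>) - 1) \<partial>F)"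
    using int by (subst nn_integral_eq_integral) auto
  also have "\<dots> \<le> (\<integral>\<^sup>+ \<mu>. ennreal (2 / S) + ennreal (4 * exp S) * ennreal (ln \<mu> powr p) \<partial>F)"
  proof (rule nn_integral_mono_AE, use AE_ge_1 in eventually_elim)
    case (elim \<mu>)
    have "T * (1 - 1 / \<mu>) \<le> S * (1 - 1 / \<mu>)" using S elim by (intro mult_right_mono) auto
    then have "exp T * exp (- T / \<mu>) - 1 \<le> exp (S * (1 - 1 / \<mu>)) - 1" unfolding eq by simp
    also have "\<dots> \<le> 2 / S + 4 * exp S * ln \<mu> powr p" by (rule le[OF elim])
    finally have "ennreal (exp T * exp (- T / \<mu>) - 1) \<le> ennreal (2 / S + 4 * exp S * ln \<mu> powr p)"
      by (rule ennreal_leI)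
    also have "\<dots> = ennreal (2 / S) + ennreal (4 * exp S) * ennreal (ln \<mu> powr p)"
      using S T by (simp add: ennreal_mult)
    finally show ?case .
  qed
  also have "\<dots> = ennreal (2 / S) + ennreal (4 * exp S) * (\<integral>\<^sup>+ \<mu>. ennreal (ln \<mu> powr p) \<partial>F)"
    by (simp add: nn_integral_add nn_integral_cmult emeasure_space_1)
  also have "\<dots> \<le> ennreal (2 / S) + ennreal (4 * exp S) * ennreal h"
    using moment by (intro add_mono mult_left_mono) auto
  also have "\<dots> = ennreal (2 / S + 4 * exp S * h)"
    using S T moment by (simp add: ennreal_mult)
  finally show ?thesis by (subst (asm) ennreal_le_iff) (use S T moment in auto)
qed

end

text \<open>\<open>threshold_bound\<close> is used twice. For a fixed \<open>S\<close> its
  conclusion fails once \<eta> is small, hence \<open>T > S\<close>; with \<open>S = T\<close> it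
  then yields the rate \<open>exp (- T) = O(\<eta> powr p)\<close>.\<close>

lemma eventually_threshold_large:
  fixes p q T0 :: real
  assumes p: "0 < p" "p < 2" and q: "0 < q" "q < 1"
  shows "\<forall>\<^sub>F \<eta> in at_right 0. \<forall>F\<in>Fclass p \<eta>. \<forall>T>0. (\<integral>\<mu>. exp (- T / \<mu>) \<partial>F) = exp (- T) / q \<longrightarrow>
     T0 \<le> T \<and> exp (- T) \<le> 8 * (q / (1 - q)) * \<eta> powr p"
proof -
  define d where "d = 1 / q - 1"
  have d: "0 < d" using q by (simp add: d_def)
  have "((\<lambda>S::real. 2 / S) \<longlongrightarrow> 0) at_top" by real_asymp
  then have "\<forall>\<^sub>F S in at_top. 2 / S < d / 2" using d by (intro order_tendstoD) auto
  with exp_minus_1_le[OF p]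
  have "\<forall>\<^sub>F S in at_top. 2 / S < d / 2 \<and>
      (\<forall>\<mu>\<ge>1. exp (S * (1 - 1 / \<mu>)) - 1 \<le> 2 / S + 4 * exp S * ln \<mu> powr p)"
    by eventually_elim simp
  then obtain S1 where S1: "\<And>S. S1 \<le> S \<Longrightarrow> 2 / S < d / 2"
    "\<And>S \<mu>. S1 \<le> S \<Longrightarrow> 1 \<le> \<mu> \<Longrightarrow> exp (S * (1 - 1 / \<mu>)) - 1 \<le> 2 / S + 4 * exp S * ln \<mu> powr p"
    by (auto simp: eventually_at_top_linorder)
  define S where "S = max S1 T0"
  have "((\<lambda>\<eta>. 4 * exp S * \<eta> powr p) \<longlongrightarrow> 0) (at_right 0)" using p by real_asymp
  then have "\<forall>\<^sub>F \<eta> in at_right 0. 4 * exp S * \<eta> powr p < d / 2"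
    using d by (intro order_tendstoD) auto
  then show ?thesis
  proof eventually_elim
    case (elim \<eta>)
    show ?case
    proof (intro ballI allI impI)
      fix F T assume F: "F \<in> Fclass p \<eta>" and T: "0 < T" "(\<integral>\<mu>. exp (- T / \<mu>) \<partial>F) = exp (- T) / q"
      interpret mixing F using F by (rule mixing_Fclass)
      have moment: "(\<integral>\<^sup>+ \<mu>. ennreal (ln \<mu> powr p) \<partial>F) \<le> ennreal (\<eta> powr p)"
        using F by (simp add: Fclass_def)
      have bound: "d / 2 \<le> 4 * exp R * \<eta> powr p" if "T \<le> R" "S1 \<le> R" for R
        using threshold_bound[OF q T moment _ that(1) S1(2)[OF that(2)]] S1(1)[OF that(2)]
        by (simp add: d_def)
      have "S < T"
      proof (rule ccontr)
        assume "\<not> S < T"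
        moreover have "S1 \<le> S" by (simp add: S_def)
        ultimately show False using bound[of S] elim by linarith
      qed
      then have "T0 \<le> T" "S1 \<le> T" by (auto simp: S_def)
      from bound[OF order_refl this(2)] have "d \<le> 8 * exp T * \<eta> powr p" by simp
      then have "exp (- T) * d \<le> exp (- T) * (8 * exp T * \<eta> powr p)"
        by (intro mult_left_mono) auto
      then have "exp (- T) \<le> 8 * \<eta> powr p / d" using d by (simp add: exp_minus field_simps)
      also have "\<dots> = 8 * (q / (1 - q)) * \<eta> powr p" using q by (simp add: d_def field_simps)
      finally show "T0 \<le> T \<and> exp (- T) \<le> 8 * (q / (1 - q)) * \<eta> powr p"
        using \<open>T0 \<le> T\<close> by simp
    qed
  qed
qed

lemma ideal_risk_upper:
  fixes p q \<delta> :: real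
  assumes p: "0 < p" "p < 2" and q: "0 < q" "q < 1" and \<delta>: "0 < \<delta>"
  shows "\<forall>\<^sub>F \<eta> in at_right 0. \<forall>F\<in>Fclass p \<eta>.
     ideal_risk q F \<le> ennreal ((max 1 (q / (1 - q)) + \<delta>) * (\<eta> powr p * ln (ln (1 / \<eta>)) powr (2 - p)))"
proof -
  define \<gamma> where "\<gamma> = q / (1 - q)"
  define c where "c = max 1 \<gamma>"
  have \<gamma>: "0 < \<gamma>" using q by (simp add: \<gamma>_def)
  have \<gamma>q: "\<gamma> * (1 / q - 1) = 1" using q by (simp add: \<gamma>_def field_simps)
  have c: "1 \<le> c" by (simp add: c_def)
  have "filterlim (\<lambda>T. (c + \<delta> / 2) * ln T powr (2 - p)) at_top at_top"
    using c \<delta> p by real_asymp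
  then have e1: "\<forall>\<^sub>F T in at_top. 10 \<le> (c + \<delta> / 2) * ln T powr (2 - p)"
    unfolding filterlim_at_top by blast
  have "((\<lambda>T. (tail_factor T + 1) * exp (- T / 2)) \<longlongrightarrow> 0) at_top"
    unfolding tail_factor_def by real_asymp
  then have e2: "\<forall>\<^sub>F T in at_top. (tail_factor T + 1) * exp (- T / 2) < 1"
    by (intro order_tendstoD) auto
  have "((\<lambda>T. 2 * (4 * T + log_sq_tail 0) * (1 / q - 1) * exp (- T / 4)) \<longlongrightarrow> 0) at_top"
    by real_asymp
  then have e3: "\<forall>\<^sub>F T in at_top. 2 * (4 * T + log_sq_tail 0) * (1 / q - 1) * exp (- T / 4) < 1"
    by (intro order_tendstoD) auto
  have e4: "\<forall>\<^sub>F T::real in at_top. exp (- T) \<le> exp (- T / 4) / 2" by real_asymp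
  note e5 = cell_risk_small_mean[OF p less_imp_le[OF \<gamma>] zero_less_one]
  have e6: "\<forall>\<^sub>F T in at_top. \<forall>\<mu>. 1 \<le> \<mu> \<longrightarrow> \<mu> \<le> 4 \<longrightarrow>
       cell_risk T \<mu> \<le> 10 * ln \<mu> powr p + (tail_factor T + 1) * exp (- T)"
    using cell_risk_small_mean[OF p order_refl zero_less_one] by simp
  note e7 = cell_risk_large_mean[OF p less_imp_le[OF \<gamma>] half_gt_zero[OF \<delta>], folded c_def]
  from eventually_ge_at_top[of 1] e1 e2 e3 e4 e5 e6 e7
  have "\<forall>\<^sub>F T in at_top. 1 \<le> T \<and> 10 \<le> (c + \<delta> / 2) * ln T powr (2 - p)
    \<and> (tail_factor T + 1) * exp (- T / 2) < 1
    \<and> 2 * (4 * T + log_sq_tail 0) * (1 / q - 1) * exp (- T / 4) < 1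
    \<and> exp (- T) \<le> exp (- T / 4) / 2
    \<and> (\<forall>\<mu>. 1 \<le> \<mu> \<longrightarrow> \<mu> \<le> 4 \<longrightarrow>
       cell_risk T \<mu> + \<gamma> * tail_factor T * (exp (- T / \<mu>) - exp (- T))
         \<le> 10 * ln \<mu> powr p + (tail_factor T + 1) * exp (- T))
    \<and> (\<forall>\<mu>. 1 \<le> \<mu> \<longrightarrow> \<mu> \<le> 4 \<longrightarrow>
       cell_risk T \<mu> \<le> 10 * ln \<mu> powr p + (tail_factor T + 1) * exp (- T))
    \<and> (\<forall>\<mu>\<ge>4. cell_risk T \<mu> + \<gamma> * tail_factor T * exp (- T / \<mu>)
         \<le> (c + \<delta> / 2) * (ln T powr (2 - p) * ln \<mu> powr p))"
    by eventually_elim (intro conjI)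
  then obtain T0 where T0: "\<And>T. T0 \<le> T \<Longrightarrow> 1 \<le> T \<and> 10 \<le> (c + \<delta> / 2) * ln T powr (2 - p)
    \<and> (tail_factor T + 1) * exp (- T / 2) < 1
    \<and> 2 * (4 * T + log_sq_tail 0) * (1 / q - 1) * exp (- T / 4) < 1
    \<and> exp (- T) \<le> exp (- T / 4) / 2
    \<and> (\<forall>\<mu>. 1 \<le> \<mu> \<longrightarrow> \<mu> \<le> 4 \<longrightarrow>
       cell_risk T \<mu> + \<gamma> * tail_factor T * (exp (- T / \<mu>) - exp (- T))
         \<le> 10 * ln \<mu> powr p + (tail_factor T + 1) * exp (- T))
    \<and> (\<forall>\<mu>. 1 \<le> \<mu> \<longrightarrow> \<mu> \<le> 4 \<longrightarrow>
       cell_risk T \<mu> \<le> 10 * ln \<mu> powr p + (tail_factor T + 1) * exp (- T))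
    \<and> (\<forall>\<mu>\<ge>4. cell_risk T \<mu> + \<gamma> * tail_factor T * exp (- T / \<mu>)
         \<le> (c + \<delta> / 2) * (ln T powr (2 - p) * ln \<mu> powr p))"
    unfolding eventually_at_top_linorder by blast
  \<comment> \<open>Replacing \<open>ln T\<close> by \<open>ln (ln (1 / \<eta>))\<close> costs the
    shift \<open>ln (2 * p)\<close>, and the leftover \<open>exp (- T)\<close> costs
    \<open>8 * \<gamma>\<close>; the second half of \<delta> absorbs both.\<close>
  have f1: "\<forall>\<^sub>F \<eta> in at_right 0. (c + \<delta> / 2) * (ln (ln (1 / \<eta>)) + ln (2 * p)) powr (2 - p) + 8 * \<gamma>
      \<le> (c + \<delta>) * ln (ln (1 / \<eta>)) powr (2 - p)"
    using c \<delta> p by real_asymp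
  have f2: "\<forall>\<^sub>F \<eta> in at_right 0. 12 \<le> (c + \<delta>) * ln (ln (1 / \<eta>)) powr (2 - p)"
    using c \<delta> p by real_asymp
  have f3: "\<forall>\<^sub>F \<eta>::real in at_right 0. 0 < \<eta> \<and> \<eta> < 1"
    by (intro eventually_conj) real_asymp+
  from f1 f2 f3 eventually_threshold_large[OF p q, of T0] show ?thesis
  proof eventually_elim
    case (elim \<eta>)
    define h where "h = \<eta> powr p"
    define L where "L = ln (ln (1 / \<eta>))"
    have h: "0 \<le> h" by (simp add: h_def)
    have l: "0 < ln (1 / \<eta>)" using elim by simp
    show ?case
    proof
      fix F assume F: "F \<in> Fclass p \<eta>"
      interpret mixing F using F by (rule mixing_Fclass)
      have moment: "(\<integral>\<^sup>+ \<mu>. ennreal (ln \<mu> powr p) \<partial>F) \<le> ennreal h"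
        using F by (simp add: Fclass_def h_def)
      from q have "ideal_risk q F \<le> ennreal ((c + \<delta>) * (h * L powr (2 - p)))"
      proof (cases rule: Tq_cases)
        case 1
        then show ?thesis by simp
      next
        case (2 T)
        have "T0 \<le> T" and eT: "exp (- T) \<le> 8 * \<gamma> * h"
          using elim F 2 by (auto simp: \<gamma>_def h_def)
        note T = T0[OF \<open>T0 \<le> T\<close>]
        have T1: "1 \<le> T" using T by blast
        define W where "W = tail_factor T"
        have W: "1 \<le> W" by (simp add: W_def tail_factor_ge_1)
        show ?thesis
        \<comment> \<open>Beyond this cutoff \<open>exp (- T / 2)\<close> is already below
          \<open>\<eta> powr p\<close>.\<close>
        proof (cases "T \<le> 2 * p * ln (1 / \<eta>)")
          case True
          define A where "A = (c + \<delta> / 2) * ln T powr (2 - p)"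
          have A: "10 \<le> A" using T by (simp add: A_def)
          \<comment> \<open>With the multiplier \<open>\<gamma> * W\<close> the term
            \<open>W * exp (- T)\<close> cancels exactly, since
            \<open>\<gamma> * (1 / q - 1) = 1\<close>; only \<open>exp (- T)\<close> is left
            over.\<close>
          have "ideal_risk q F \<le> ennreal (A * h + ((W + 1) + (0 - \<gamma> * W) * (1 / q - 1)) * exp (- T))"
          proof (rule ideal_risk_le[OF q 2 moment h])
            fix \<mu> :: real assume \<mu>: "1 \<le> \<mu>"
            show "cell_risk T \<mu> + \<gamma> * W * (exp (- T / \<mu>) - exp (- T))
                \<le> A * ln \<mu> powr p + (W + 1) * exp (- T) + 0 * (exp (- T / \<mu>) - exp (- T))"
            proof (cases "\<mu> \<le> 4")
              case True
              then have "cell_risk T \<mu> + \<gamma> * W * (exp (- T / \<mu>) - exp (- T))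
                  \<le> 10 * ln \<mu> powr p + (W + 1) * exp (- T)"
                using T \<mu> by (simp add: W_def)
              moreover have "10 * ln \<mu> powr p \<le> A * ln \<mu> powr p"
                using A by (intro mult_right_mono) auto
              ultimately show ?thesis by simp
            next
              case False
              then have "cell_risk T \<mu> + \<gamma> * W * exp (- T / \<mu>) \<le> A * ln \<mu> powr p"
                using T by (simp add: W_def A_def mult.assoc)
              moreover have "0 \<le> \<gamma> * W * exp (- T)" "0 \<le> (W + 1) * exp (- T)"
                using \<gamma> W by auto
              ultimately show ?thesis by (simp add: right_diff_distrib)
            qed
          qed (use A \<gamma> W in auto)
          also have "(W + 1) + (0 - \<gamma> * W) * (1 / q - 1) = 1 + W * (1 - \<gamma> * (1 / q - 1))"
            by (simp add: algebra_simps)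
          also have "\<dots> = 1" by (simp add: \<gamma>q)
          also have "ennreal (A * h + 1 * exp (- T)) \<le> ennreal ((c + \<delta>) * (h * L powr (2 - p)))"
          proof (rule ennreal_leI)
            have "ln T \<le> ln (2 * p * ln (1 / \<eta>))"
              using True T1 by simp
            also have "\<dots> = L + ln (2 * p)" unfolding L_def using p l by (subst ln_mult) auto
            finally have "A \<le> (c + \<delta> / 2) * (L + ln (2 * p)) powr (2 - p)"
              unfolding A_def using T1 c \<delta> p by (intro mult_left_mono powr_mono2) auto
            then have "A + 8 * \<gamma> \<le> (c + \<delta>) * L powr (2 - p)"
              using elim by (simp add: L_def)
            then have "(A + 8 * \<gamma>) * h \<le> (c + \<delta>) * L powr (2 - p) * h"
              using h by (rule mult_right_mono)
            then show "A * h + 1 * exp (- T) \<le> (c + \<delta>) * (h * L powr (2 - p))"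
              using eT by (simp add: algebra_simps)
          qed
          finally show ?thesis .
        next
          case False
          \<comment> \<open>For means above 4, \<open>exp (- T / \<mu>) - exp (- T)\<close> is at
            least \<open>exp (- T / 4) / 2\<close>; \<open>D\<close> is chosen so that this lower
            bound times \<open>D\<close> equals the uniform bound
            \<open>4 * T + log_sq_tail 0\<close>.\<close>
          define D where "D = 2 * (4 * T + log_sq_tail 0) * exp (T / 4)"
          have D: "0 \<le> D" unfolding D_def using T1 log_sq_tail_nonneg[of 0] by simp
          have "ideal_risk q F \<le> ennreal (10 * h + ((W + 1) + (D - 0) * (1 / q - 1)) * exp (- T))"
          proof (rule ideal_risk_le[OF q 2 moment h])
            fix \<mu> :: real assume \<mu>: "1 \<le> \<mu>"
            show "cell_risk T \<mu> + 0 * (exp (- T / \<mu>) - exp (- T))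
                \<le> 10 * ln \<mu> powr p + (W + 1) * exp (- T) + D * (exp (- T / \<mu>) - exp (- T))"
            proof (cases "\<mu> \<le> 4")
              case True
              then have "cell_risk T \<mu> \<le> 10 * ln \<mu> powr p + (W + 1) * exp (- T)"
                using T \<mu> by (simp add: W_def)
              moreover have "0 \<le> D * (exp (- T / \<mu>) - exp (- T))"
                using D \<mu> T1 mult_left_mono[of 1 \<mu> T]
                by (intro mult_nonneg_nonneg) (auto simp: field_simps)
              ultimately show ?thesis by simp
            next
              case False
              have "T / \<mu> \<le> T / 4" using False T1 by (intro divide_left_mono) auto
              then have "exp (- T / 4) \<le> exp (- T / \<mu>)" by simp
              then have "exp (- T / 4) / 2 \<le> exp (- T / \<mu>) - exp (- T)" using T by linarith
              then have "D * (exp (- T / 4) / 2) \<le> D * (exp (- T / \<mu>) - exp (- T))"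
                using D by (intro mult_left_mono) auto
              moreover have "D * (exp (- T / 4) / 2) = 4 * T + log_sq_tail 0"
                by (simp add: D_def exp_minus field_simps)
              moreover have "cell_risk T \<mu> \<le> 4 * T + log_sq_tail 0"
                using T1 \<mu> by (intro cell_risk_le_linear) auto
              moreover have "0 \<le> 10 * ln \<mu> powr p" "0 \<le> (W + 1) * exp (- T)"
                using W by auto
              ultimately show ?thesis by linarith
            qed
          qed (use D W in auto)
          also have "\<dots> \<le> ennreal ((c + \<delta>) * (h * L powr (2 - p)))"
          proof (rule ennreal_leI)
            \<comment> \<open>One factor \<open>exp (- T / 2)\<close> supplies \<open>h\<close>; the
              remaining exponential decay absorbs \<open>W\<close> or the linear growth in
              \<open>D\<close>. Each of the two terms is at most \<open>h\<close>, which gives 12 in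
              total.\<close>
            have half: "exp (- T) = exp (- T / 2) * exp (- T / 2)"
              by (simp add: exp_add[symmetric])
            have "exp (- T / 2) \<le> exp (- (p * ln (1 / \<eta>)))" using False by simp
            also have "\<dots> = h" using elim by (simp add: h_def powr_def ln_div)
            finally have eh: "exp (- T / 2) \<le> h" .
            have "(W + 1) * exp (- T) = ((W + 1) * exp (- T / 2)) * exp (- T / 2)"
              by (simp add: half)
            also have "\<dots> \<le> 1 * h" using T eh W by (intro mult_mono) (auto simp: W_def)
            finally have 1: "(W + 1) * exp (- T) \<le> h" by simp
            have "D * (1 / q - 1) * exp (- T)
              = (2 * (4 * T + log_sq_tail 0) * (1 / q - 1)) * (exp (T / 4) * exp (- T))"
              by (simp add: D_def)
            also have "exp (T / 4) * exp (- T) = exp (- T / 4) * exp (- T / 2)"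
              by (simp add: exp_add[symmetric])
            also have "(2 * (4 * T + log_sq_tail 0) * (1 / q - 1)) * (exp (- T / 4) * exp (- T / 2))
              = (2 * (4 * T + log_sq_tail 0) * (1 / q - 1) * exp (- T / 4)) * exp (- T / 2)"
              by simp
            also have "\<dots> \<le> 1 * h" using T eh by (intro mult_mono) auto
            finally have 2: "D * (1 / q - 1) * exp (- T) \<le> h" by simp
            have "10 * h + ((W + 1) + (D - 0) * (1 / q - 1)) * exp (- T) \<le> 12 * h"
              using 1 2 by (simp add: algebra_simps)
            also have "\<dots> \<le> (c + \<delta>) * L powr (2 - p) * h"
              using elim h by (intro mult_right_mono) (auto simp: L_def)
            finally show "10 * h + ((W + 1) + (D - 0) * (1 / q - 1)) * exp (- T)
                \<le> (c + \<delta>) * (h * L powr (2 - p))" by (simp add: algebra_simps)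
          qed
          finally show ?thesis .
        qed
      qed
      then show "ideal_risk q F \<le> ennreal ((max 1 (q / (1 - q)) + \<delta>)
          * (\<eta> powr p * ln (ln (1 / \<eta>)) powr (2 - p)))"
        by (simp add: c_def \<gamma>_def h_def L_def)
    qed
  qed
qed

section \<open>Two-point mixtures\<close>

lemma borel_measurable_delta [measurable]: "delta t \<in> borel_measurable borel"
  unfolding delta_def by measurable

text \<open>Only integrals of Borel functions enter \<open>mixcdf\<close> and the risk, so
  coarsening the sigma-algebra of \<open>M\<close> to the Borel sets changes neither.\<close>

lemma ideal_risk_distr:
  assumes [measurable]: "(\<lambda>x. x) \<in> measurable M borel"
  shows "ideal_risk q (distr M borel (\<lambda>x. x)) = ideal_risk q M"
proof -
  have "mixcdf (distr M borel (\<lambda>x. x)) t = mixcdf M t" for t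
    unfolding mixcdf_def by (subst integral_distr) (auto simp: Ecdf_def)
  then have "mixcdf (distr M borel (\<lambda>x. x)) = mixcdf M" by auto
  then show ?thesis unfolding ideal_risk_def by (subst nn_integral_distr) auto
qed

text \<open>The point masses of \<^const>\<open>two_point\<close> live on the discrete \<open>\<sigma>\<close>-algebra, so membership
  in \<^const>\<open>Fclass\<close> needs the transport to the Borel sets.\<close>

definition two_point_borel :: "real \<Rightarrow> real \<Rightarrow> real measure" where
  "two_point_borel \<epsilon> \<mu> = distr (two_point \<epsilon> \<mu>) borel (\<lambda>x. x)"

lemma measurable_two_point: "(\<lambda>x. x) \<in> measurable (two_point \<epsilon> \<mu>) borel"
  by (simp add: two_point_def)

lemma ideal_risk_two_point_borel: "ideal_risk q (two_point_borel \<epsilon> \<mu>) = ideal_risk q (two_point \<epsilon> \<mu>)"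
  unfolding two_point_borel_def by (rule ideal_risk_distr[OF measurable_two_point])

lemma nn_integral_two_point_borel:
  assumes "0 \<le> \<epsilon>" "\<epsilon> \<le> 1" "f \<in> borel_measurable borel"
  shows "(\<integral>\<^sup>+ x. f x \<partial>two_point_borel \<epsilon> \<mu>) = ennreal \<epsilon> * f \<mu> + ennreal (1 - \<epsilon>) * f 1"
  unfolding two_point_borel_def using assms
  by (subst nn_integral_distr[OF measurable_two_point])
     (auto simp: two_point_def nn_integral_map_pmf mult.commute)

lemma integral_two_point_borel:
  fixes f :: "real \<Rightarrow> real"
  assumes "0 \<le> \<epsilon>" "\<epsilon> \<le> 1" "f \<in> borel_measurable borel"
  shows "(\<integral> x. f x \<partial>two_point_borel \<epsilon> \<mu>) = \<epsilon> * f \<mu> + (1 - \<epsilon>) * f 1"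
  unfolding two_point_borel_def using assms
  by (subst integral_distr[OF measurable_two_point]) (auto simp: two_point_def)

lemma mixing_two_point_borel:
  assumes "0 \<le> \<epsilon>" "\<epsilon> \<le> 1" "1 \<le> \<mu>"
  shows "mixing (two_point_borel \<epsilon> \<mu>)"
proof -
  interpret prob_space "two_point \<epsilon> \<mu>" unfolding two_point_def by (rule prob_space_measure_pmf)
  have "AE x in two_point \<epsilon> \<mu>. 1 \<le> x"
    unfolding two_point_def using assms by (subst AE_measure_pmf_iff) auto
  then show ?thesis
    using prob_space_distr[OF measurable_two_point]
    unfolding mixing_def mixing_axioms_def two_point_borel_def
    by (auto simp: AE_distr_iff[OF measurable_two_point])
qed

text \<open>The choice of \<epsilon> meets the moment constraint with equality, as the mass at 1
  contributes nothing.\<close>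

lemma two_point_borel_Fclass:
  assumes "0 < p" "1 < \<mu>" "\<epsilon> = \<eta> powr p / ln \<mu> powr p" "\<epsilon> \<le> 1"
  shows "two_point_borel \<epsilon> \<mu> \<in> Fclass p \<eta>"
proof -
  have "0 \<le> \<epsilon>" using assms by simp
  interpret mixing "two_point_borel \<epsilon> \<mu>" using assms by (intro mixing_two_point_borel) auto
  have "(\<integral>\<^sup>+ x. ennreal (ln x powr p) \<partial>two_point_borel \<epsilon> \<mu>) = ennreal (\<eta> powr p)"
    using assms \<open>0 \<le> \<epsilon>\<close> by (subst nn_integral_two_point_borel) (auto simp: ennreal_mult[symmetric])
  then show ?thesis
    using prob_space_axioms sets_F AE_ge_1 by (simp add: Fclass_def)
qed

text \<open>Divided by \<open>exp (- T)\<close>, the threshold equation is linear in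
  \<open>exp (T * (1 - 1 / \<mu>))\<close>, which yields \<open>T\<close> in closed form. The lower
  bound keeps the variance of the mean-1 component and the bias of the other one.\<close>

lemma two_point_risk_ge:
  fixes q \<epsilon> \<mu> :: real
  defines "\<gamma> \<equiv> q / (1 - q)"
  defines "T \<equiv> ln (1 + 1 / (\<gamma> * \<epsilon>)) / (1 - 1 / \<mu>)"
  assumes q: "0 < q" "q < 1" and \<epsilon>: "0 < \<epsilon>" "\<epsilon> \<le> 1" and \<mu>: "1 < \<mu>" and T1: "1 \<le> T"
  shows "ennreal (\<epsilon> * ((1 - \<epsilon>) * \<gamma> * (exp (- T / \<mu>) - exp (- T)) * (ln T)\<^sup>2
      + (1 - exp (- T / \<mu>)) * (ln \<mu>)\<^sup>2)) \<le> ideal_risk q (two_point \<epsilon> \<mu>)"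
proof -
  have \<gamma>: "0 < \<gamma>" using q by (simp add: \<gamma>_def)
  have arg: "0 < 1 + 1 / (\<gamma> * \<epsilon>)" using \<gamma> \<epsilon> by (simp add: add_pos_pos)
  interpret mixing "two_point_borel \<epsilon> \<mu>" using \<epsilon> \<mu> by (intro mixing_two_point_borel) auto
  have k: "(\<integral>x. exp (- t / x) \<partial>two_point_borel \<epsilon> \<mu>)
      = exp (- t) * (\<epsilon> * exp (t * (1 - 1 / \<mu>)) + (1 - \<epsilon>))" for t
    using \<epsilon> by (subst integral_two_point_borel) (auto simp: algebra_simps exp_add[symmetric])
  have q_iff: "\<epsilon> * y + (1 - \<epsilon>) = 1 / q \<longleftrightarrow> y = 1 + 1 / (\<gamma> * \<epsilon>)" for y
    using q \<epsilon> by (auto simp: \<gamma>_def field_simps)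
  have expT: "exp (T * (1 - 1 / \<mu>)) = 1 + 1 / (\<gamma> * \<epsilon>)"
    using \<mu> arg by (simp add: T_def)
  from q have "ideal_risk q (two_point_borel \<epsilon> \<mu>)
      = (\<integral>\<^sup>+ x. ennreal (cell_risk T x) \<partial>two_point_borel \<epsilon> \<mu>)"
  proof (cases rule: Tq_cases)
    case 1
    have "\<epsilon> * exp (T * (1 - 1 / \<mu>)) + (1 - \<epsilon>) = 1 / q" using q_iff expT by simp
    then have False using 1(1)[of T] T1 unfolding k by simp
    then show ?thesis ..
  next
    case (2 T')
    have "exp (- T') * (\<epsilon> * exp (T' * (1 - 1 / \<mu>)) + (1 - \<epsilon>)) = exp (- T') * (1 / q)"
      using 2(3) unfolding k by simp
    then have "\<epsilon> * exp (T' * (1 - 1 / \<mu>)) + (1 - \<epsilon>) = 1 / q"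
      by (subst (asm) mult_cancel_left) simp
    then have "exp (T' * (1 - 1 / \<mu>)) = exp (T * (1 - 1 / \<mu>))"
      using q_iff expT by simp
    then have "T' = T" using \<mu> by simp
    with 2 show ?thesis by (intro ideal_risk_eq) auto
  qed
  also have "\<dots> = ennreal (\<epsilon> * cell_risk T \<mu> + (1 - \<epsilon>) * cell_risk T 1)"
    using \<epsilon> T1 \<mu> cell_risk_nonneg[of T \<mu>] cell_risk_nonneg[of T 1]
    by (subst nn_integral_two_point_borel) (auto simp: ennreal_mult)
  finally have eq: "ideal_risk q (two_point \<epsilon> \<mu>) = ennreal (\<epsilon> * cell_risk T \<mu> + (1 - \<epsilon>) * cell_risk T 1)"
    by (simp add: ideal_risk_two_point_borel)
  \<comment> \<open>The threshold equation trades \<open>exp (- T)\<close> for a multiple of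
    \<epsilon>, so that both components contribute with the common factor \<epsilon>.\<close>
  have "\<gamma> * \<epsilon> * (exp (- T / \<mu>) - exp (- T)) = exp (- T) * (\<gamma> * \<epsilon> * (exp (T * (1 - 1 / \<mu>)) - 1))"
    by (simp add: algebra_simps exp_add[symmetric])
  also have "\<dots> = exp (- T)" unfolding expT using \<gamma> \<epsilon> by simp
  finally have "exp (- T) = \<gamma> * \<epsilon> * (exp (- T / \<mu>) - exp (- T))" by simp
  moreover have "exp (- T) * (ln T)\<^sup>2 \<le> cell_risk T 1"
    using log_sq_tail_lower[OF T1] by (simp add: cell_risk_def)
  ultimately have "\<gamma> * \<epsilon> * (exp (- T / \<mu>) - exp (- T)) * (ln T)\<^sup>2 \<le> cell_risk T 1" by simp
  then have "(1 - \<epsilon>) * (\<gamma> * \<epsilon> * (exp (- T / \<mu>) - exp (- T)) * (ln T)\<^sup>2) \<le> (1 - \<epsilon>) * cell_risk T 1"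
    using \<epsilon> by (intro mult_left_mono) auto
  moreover have "\<epsilon> * ((1 - exp (- T / \<mu>)) * (ln \<mu>)\<^sup>2) \<le> \<epsilon> * cell_risk T \<mu>"
    using \<epsilon> log_sq_tail_nonneg by (intro mult_left_mono) (auto simp: cell_risk_def)
  ultimately show ?thesis unfolding eq
    by (intro ennreal_leI) (simp add: algebra_simps)
qed

text \<open>Between the two extreme choices of \<open>m\<close> one has
  \<open>ln m ~ ln T ~ L\<close>, so after normalization the lower bound behaves like
  \<open>(1 - e) + \<gamma> * e\<close> with \<open>e = exp (- T / m)\<close>. For
  \<open>q = 1/2\<close> this is 1 whatever \<open>e\<close> is; otherwise \<open>alt\<close> drives
  \<open>e\<close> to the endpoint with the larger value.\<close>

lemma two_point_risk_lower:
  fixes q p :: real and m :: "real \<Rightarrow> real"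
  assumes q: "0 < q" "q < 1" and p: "0 < p" "p < 2"
    and m: "\<forall>\<^sub>F \<eta> in at_right 0. ln (1 / \<eta>) / ln (ln (1 / \<eta>)) \<le> m \<eta>"
      "\<forall>\<^sub>F \<eta> in at_right 0. m \<eta> \<le> ln (1 / \<eta>) * ln (ln (1 / \<eta>))"
    and alt: "q = 1/2
      \<or> q < 1/2 \<and> filterlim (\<lambda>\<eta>. ln (1 / \<eta>) / m \<eta>) at_top (at_right 0)
      \<or> 1/2 < q \<and> ((\<lambda>\<eta>. ln (1 / \<eta>) / m \<eta>) \<longlongrightarrow> 0) (at_right 0)"
    and \<delta>: "0 < \<delta>"
  shows "\<forall>\<^sub>F \<eta> in at_right 0.
      two_point_borel (\<eta> powr p / ln (m \<eta>) powr p) (m \<eta>) \<in> Fclass p \<eta> \<and>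
      ennreal (((if q \<le> 1/2 then 1 else q / (1 - q)) - \<delta>) * (\<eta> powr p * ln (ln (1 / \<eta>)) powr (2 - p)))
        \<le> ideal_risk q (two_point (\<eta> powr p / ln (m \<eta>) powr p) (m \<eta>))"
proof -
  define \<gamma> where "\<gamma> = q / (1 - q)"
  define c where "c = (if q \<le> 1/2 then 1 else \<gamma>)"
  define l where "l \<eta> = ln (1 / \<eta>)" for \<eta> :: real
  define L where "L \<eta> = ln (l \<eta>)" for \<eta>
  define \<epsilon> where "\<epsilon> \<eta> = \<eta> powr p / ln (m \<eta>) powr p" for \<eta>
  define T where "T \<eta> = ln (1 + 1 / (\<gamma> * \<epsilon> \<eta>)) / (1 - 1 / m \<eta>)" for \<eta>
  have \<gamma>: "0 < \<gamma>" using q by (simp add: \<gamma>_def)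
  have ev\<eta>: "\<forall>\<^sub>F \<eta>::real in at_right 0. 0 < \<eta> \<and> \<eta> < 1"
    by (intro eventually_conj) real_asymp+
  have l_top: "filterlim l at_top (at_right 0)" unfolding l_def by real_asymp
  have L_top: "filterlim L at_top (at_right 0)" unfolding L_def l_def by real_asymp
  have evl: "\<forall>\<^sub>F \<eta> in at_right 0. 0 < l \<eta>"
    using l_top by (simp add: filterlim_at_top_dense)
  have evL: "\<forall>\<^sub>F \<eta> in at_right 0. 0 < L \<eta>"
    using L_top by (simp add: filterlim_at_top_dense)
  have m_top: "filterlim m at_top (at_right 0)"
  proof (rule filterlim_at_top_mono[OF _ m(1)])
    show "filterlim (\<lambda>\<eta>::real. ln (1 / \<eta>) / ln (ln (1 / \<eta>))) at_top (at_right 0)" by real_asymp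
  qed
  have evm: "\<forall>\<^sub>F \<eta> in at_right 0. 1 < m \<eta>"
    using m_top by (simp add: filterlim_at_top_dense)
  have lnm_top: "filterlim (\<lambda>\<eta>. ln (m \<eta>)) at_top (at_right 0)"
    by (rule filterlim_compose[OF ln_at_top m_top])
  have evlnm: "\<forall>\<^sub>F \<eta> in at_right 0. 1 < ln (m \<eta>)"
    using lnm_top by (simp add: filterlim_at_top_dense)
  have lnm_L: "((\<lambda>\<eta>. ln (m \<eta>) / L \<eta>) \<longlongrightarrow> 1) (at_right 0)"
  proof (rule tendsto_sandwich)
    show "((\<lambda>\<eta>. ln (l \<eta> / L \<eta>) / L \<eta>) \<longlongrightarrow> 1) (at_right 0)"
      unfolding L_def l_def by real_asymp
    show "((\<lambda>\<eta>. ln (l \<eta> * L \<eta>) / L \<eta>) \<longlongrightarrow> 1) (at_right 0)"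
      unfolding L_def l_def by real_asymp
    show "\<forall>\<^sub>F \<eta> in at_right 0. ln (l \<eta> / L \<eta>) / L \<eta> \<le> ln (m \<eta>) / L \<eta>"
      using m(1) evl evL evm
      by eventually_elim (auto intro!: divide_right_mono simp: l_def L_def)
    show "\<forall>\<^sub>F \<eta> in at_right 0. ln (m \<eta>) / L \<eta> \<le> ln (l \<eta> * L \<eta>) / L \<eta>"
      using m(2) evl evL evm
      by eventually_elim (auto intro!: divide_right_mono simp: l_def L_def)
  qed
  have inv_m: "((\<lambda>\<eta>. 1 / m \<eta>) \<longlongrightarrow> 0) (at_right 0)"
    using tendsto_inverse_0_at_top[OF m_top] by (simp add: inverse_eq_divide)
  have inv_L: "((\<lambda>\<eta>. 1 / L \<eta>) \<longlongrightarrow> 0) (at_right 0)"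
    using tendsto_inverse_0_at_top[OF L_top] by (simp add: inverse_eq_divide)
  have inv_l: "((\<lambda>\<eta>. 1 / l \<eta>) \<longlongrightarrow> 0) (at_right 0)"
    using tendsto_inverse_0_at_top[OF l_top] by (simp add: inverse_eq_divide)
  have ev\<epsilon>: "\<forall>\<^sub>F \<eta> in at_right 0. 0 < \<epsilon> \<eta> \<and> \<epsilon> \<eta> \<le> \<eta> powr p"
    using ev\<eta> evlnm
  proof eventually_elim
    case (elim \<eta>)
    have "1 \<le> ln (m \<eta>) powr p" using elim p by (intro ge_one_powr_ge_zero) auto
    then show ?case using elim mult_left_mono[of 1 "ln (m \<eta>) powr p" "\<eta> powr p"]
      by (auto simp: \<epsilon>_def divide_le_eq)
  qed
  have \<epsilon>_0: "(\<epsilon> \<longlongrightarrow> 0) (at_right 0)"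
  proof (rule tendsto_sandwich[OF _ _ tendsto_const])
    show "((\<lambda>\<eta>::real. \<eta> powr p) \<longlongrightarrow> 0) (at_right 0)" using p by real_asymp
  qed (use ev\<epsilon> in \<open>auto elim: eventually_mono\<close>)
  then have ev\<epsilon>1: "\<forall>\<^sub>F \<eta> in at_right 0. \<epsilon> \<eta> < 1" by (intro order_tendstoD) auto
  have lnlnm_l: "((\<lambda>\<eta>. ln (ln (m \<eta>)) / l \<eta>) \<longlongrightarrow> 0) (at_right 0)"
  proof (rule tendsto_sandwich[OF _ _ tendsto_const])
    have "((\<lambda>\<eta>. L \<eta> / l \<eta>) \<longlongrightarrow> 0) (at_right 0)" unfolding L_def l_def by real_asymp
    from tendsto_mult[OF lnm_L this]
    have "((\<lambda>\<eta>. (ln (m \<eta>) / L \<eta>) * (L \<eta> / l \<eta>)) \<longlongrightarrow> 0) (at_right 0)" by simp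
    then show "((\<lambda>\<eta>. ln (m \<eta>) / l \<eta>) \<longlongrightarrow> 0) (at_right 0)"
      by (rule Lim_transform_eventually) (use evL in eventually_elim, simp)
    show "\<forall>\<^sub>F \<eta> in at_right 0. 0 \<le> ln (ln (m \<eta>)) / l \<eta>"
      using evlnm evl by eventually_elim simp
    show "\<forall>\<^sub>F \<eta> in at_right 0. ln (ln (m \<eta>)) / l \<eta> \<le> ln (m \<eta>) / l \<eta>"
      using evlnm evl
      by eventually_elim (auto intro!: divide_right_mono order_trans[OF ln_le_minus_one])
  qed
  \<comment> \<open>Here \<open>ln \<epsilon> = - p * l - p * ln (ln m)\<close>; after division by
    \<open>l\<close> only the first term survives in the closed form of \<open>T\<close>.\<close>
  have T_l: "((\<lambda>\<eta>. T \<eta> / l \<eta>) \<longlongrightarrow> p) (at_right 0)"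
  proof (rule Lim_transform_eventually)
    have "((\<lambda>\<eta>. ((ln (\<gamma> * \<epsilon> \<eta> + 1) - ln \<gamma>) * (1 / l \<eta>) + p + p * (ln (ln (m \<eta>)) / l \<eta>)) / (1 - 1 / m \<eta>))
       \<longlongrightarrow> ((ln (\<gamma> * 0 + 1) - ln \<gamma>) * 0 + p + p * 0) / (1 - 0)) (at_right 0)"
      by (intro tendsto_intros \<epsilon>_0 inv_l lnlnm_l inv_m) auto
    then show "((\<lambda>\<eta>. ((ln (\<gamma> * \<epsilon> \<eta> + 1) - ln \<gamma>) * (1 / l \<eta>) + p + p * (ln (ln (m \<eta>)) / l \<eta>)) / (1 - 1 / m \<eta>))
       \<longlongrightarrow> p) (at_right 0)" by simp
    show "\<forall>\<^sub>F \<eta> in at_right 0. ((ln (\<gamma> * \<epsilon> \<eta> + 1) - ln \<gamma>) * (1 / l \<eta>) + p + p * (ln (ln (m \<eta>)) / l \<eta>))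
        / (1 - 1 / m \<eta>) = T \<eta> / l \<eta>"
      using ev\<eta> evl evlnm ev\<epsilon>
    proof eventually_elim
      case (elim \<eta>)
      have pos: "0 < \<gamma> * \<epsilon> \<eta>" using \<gamma> elim by simp
      have ln\<epsilon>: "ln (\<epsilon> \<eta>) = - p * l \<eta> - p * ln (ln (m \<eta>))"
        using elim by (simp add: \<epsilon>_def l_def ln_div ln_powr)
      have eq: "1 + 1 / (\<gamma> * \<epsilon> \<eta>) = (\<gamma> * \<epsilon> \<eta> + 1) / (\<gamma> * \<epsilon> \<eta>)"
        using pos by (auto simp: add_divide_distrib)
      have "ln (1 + 1 / (\<gamma> * \<epsilon> \<eta>)) = ln (\<gamma> * \<epsilon> \<eta> + 1) - ln (\<gamma> * \<epsilon> \<eta>)"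
        unfolding eq using pos by (subst ln_div) auto
      moreover have "ln (\<gamma> * \<epsilon> \<eta>) = ln \<gamma> + ln (\<epsilon> \<eta>)" using \<gamma> elim by (simp add: ln_mult)
      ultimately have "ln (1 + 1 / (\<gamma> * \<epsilon> \<eta>))
          = ln (\<gamma> * \<epsilon> \<eta> + 1) - ln \<gamma> + p * l \<eta> + p * ln (ln (m \<eta>))"
        using ln\<epsilon> by simp
      then have "ln (1 + 1 / (\<gamma> * \<epsilon> \<eta>)) / l \<eta>
          = (ln (\<gamma> * \<epsilon> \<eta> + 1) - ln \<gamma>) * (1 / l \<eta>) + p + p * (ln (ln (m \<eta>)) / l \<eta>)"
        using elim by (simp add: add_divide_distrib)
      moreover have "T \<eta> / l \<eta> = (ln (1 + 1 / (\<gamma> * \<epsilon> \<eta>)) / l \<eta>) / (1 - 1 / m \<eta>)"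
        by (simp add: T_def mult.commute)
      ultimately show ?case by (simp only:)
    qed
  qed
  have T_top: "filterlim T at_top (at_right 0)"
  proof -
    have "filterlim (\<lambda>\<eta>. (T \<eta> / l \<eta>) * l \<eta>) at_top (at_right 0)"
      by (rule filterlim_tendsto_pos_mult_at_top[OF T_l p(1) l_top])
    moreover have "\<forall>\<^sub>F \<eta> in at_right 0. (T \<eta> / l \<eta>) * l \<eta> = T \<eta>"
      using evl by eventually_elim simp
    ultimately show ?thesis by (simp cong: filterlim_cong add: filterlim_cong)
  qed
  have evT: "\<forall>\<^sub>F \<eta> in at_right 0. 1 < T \<eta>"
    using T_top by (simp add: filterlim_at_top_dense)
  have lnT_L: "((\<lambda>\<eta>. ln (T \<eta>) / L \<eta>) \<longlongrightarrow> 1) (at_right 0)"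
  proof (rule Lim_transform_eventually)
    have "((\<lambda>\<eta>. 1 + ln (T \<eta> / l \<eta>) * (1 / L \<eta>)) \<longlongrightarrow> 1 + ln p * 0) (at_right 0)"
      using p by (intro tendsto_intros T_l inv_L) auto
    then show "((\<lambda>\<eta>. 1 + ln (T \<eta> / l \<eta>) * (1 / L \<eta>)) \<longlongrightarrow> 1) (at_right 0)" by simp
    show "\<forall>\<^sub>F \<eta> in at_right 0. 1 + ln (T \<eta> / l \<eta>) * (1 / L \<eta>) = ln (T \<eta>) / L \<eta>"
      using evl evL evT
    proof eventually_elim
      case (elim \<eta>)
      then have "ln (T \<eta> / l \<eta>) = ln (T \<eta>) - L \<eta>" by (simp add: ln_div L_def)
      then show ?case using elim by (simp add: diff_divide_distrib)
    qed
  qed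
  define e where "e \<eta> = exp (- T \<eta> / m \<eta>)" for \<eta>
  have eT: "((\<lambda>\<eta>. exp (- T \<eta>)) \<longlongrightarrow> 0) (at_right 0)"
    using filterlim_compose[OF exp_at_bot filterlim_uminus_at_top[THEN iffD1, OF T_top]] .
  have eve: "\<forall>\<^sub>F \<eta> in at_right 0. norm (e \<eta>) \<le> 1"
    using evT evm by eventually_elim (auto simp: e_def)
  have T_m: "\<forall>\<^sub>F \<eta> in at_right 0. (T \<eta> / l \<eta>) * (l \<eta> / m \<eta>) = T \<eta> / m \<eta>"
    using evl by eventually_elim simp
  \<comment> \<open>Stated for the product because \<open>e\<close> itself need not converge when
    \<open>q = 1/2\<close>, where \<open>\<gamma> - 1\<close> vanishes.\<close>
  have e_lim: "((\<lambda>\<eta>. (\<gamma> - 1) * e \<eta>) \<longlongrightarrow> c - 1) (at_right 0)"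
    using alt
  proof (elim disjE conjE)
    assume "q = 1/2"
    then have "\<gamma> = 1" by (simp add: \<gamma>_def)
    then show ?thesis using \<open>q = 1/2\<close> by (simp add: c_def)
  next
    assume q2: "q < 1/2" and lim: "filterlim (\<lambda>\<eta>. ln (1 / \<eta>) / m \<eta>) at_top (at_right 0)"
    have "filterlim (\<lambda>\<eta>. (T \<eta> / l \<eta>) * (l \<eta> / m \<eta>)) at_top (at_right 0)"
      using lim unfolding l_def[symmetric]
      by (rule filterlim_tendsto_pos_mult_at_top[OF T_l p(1)])
    then have "filterlim (\<lambda>\<eta>. T \<eta> / m \<eta>) at_top (at_right 0)"
      using filterlim_cong[OF refl refl T_m] by simp
    then have "filterlim (\<lambda>\<eta>. - (T \<eta> / m \<eta>)) at_bot (at_right 0)"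
      by (simp add: filterlim_uminus_at_top)
    from filterlim_compose[OF exp_at_bot this] have "(e \<longlongrightarrow> 0) (at_right 0)"
      by (simp add: e_def[abs_def])
    then have "((\<lambda>\<eta>. (\<gamma> - 1) * e \<eta>) \<longlongrightarrow> (\<gamma> - 1) * 0) (at_right 0)" by (intro tendsto_intros)
    then show ?thesis using q2 by (simp add: c_def)
  next
    assume q2: "1/2 < q" and lim: "((\<lambda>\<eta>. ln (1 / \<eta>) / m \<eta>) \<longlongrightarrow> 0) (at_right 0)"
    have "((\<lambda>\<eta>. (T \<eta> / l \<eta>) * (l \<eta> / m \<eta>)) \<longlongrightarrow> p * 0) (at_right 0)"
      using lim unfolding l_def[symmetric] by (rule tendsto_mult[OF T_l])
    then have "((\<lambda>\<eta>. T \<eta> / m \<eta>) \<longlongrightarrow> 0) (at_right 0)"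
      using Lim_transform_eventually[OF _ T_m] by simp
    then have "((\<lambda>\<eta>. (\<gamma> - 1) * exp (- (T \<eta> / m \<eta>))) \<longlongrightarrow> (\<gamma> - 1) * exp (- 0)) (at_right 0)"
      by (intro tendsto_intros)
    then show ?thesis using q2 by (simp add: c_def e_def)
  qed
  define A where "A \<eta> = (1 - \<epsilon> \<eta>) * \<gamma> * (ln (T \<eta>) / L \<eta>)\<^sup>2" for \<eta>
  define B where "B \<eta> = (ln (m \<eta>) / L \<eta>)\<^sup>2" for \<eta>
  have "(A \<longlongrightarrow> (1 - 0) * \<gamma> * 1\<^sup>2) (at_right 0)"
    unfolding A_def[abs_def] by (intro tendsto_intros \<epsilon>_0 lnT_L)
  then have A: "(A \<longlongrightarrow> \<gamma>) (at_right 0)" by simp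
  have "(B \<longlongrightarrow> 1\<^sup>2) (at_right 0)"
    unfolding B_def[abs_def] by (intro tendsto_intros lnm_L)
  then have B: "(B \<longlongrightarrow> 1) (at_right 0)" by simp
  \<comment> \<open>A null sequence times the bounded \<open>e\<close> is null, so
    \<open>A - B\<close> may be replaced by its limit \<open>\<gamma> - 1\<close> without a limit
    for \<open>e\<close>.\<close>
  have "((\<lambda>\<eta>. A \<eta> - B \<eta> - (\<gamma> - 1)) \<longlongrightarrow> \<gamma> - 1 - (\<gamma> - 1)) (at_right 0)"
    by (intro tendsto_intros A B)
  then have "((\<lambda>\<eta>. (A \<eta> - B \<eta> - (\<gamma> - 1)) * e \<eta>) \<longlongrightarrow> 0) (at_right 0)"
    using eve by (intro lim_null_mult_right_bounded[where B=1]) auto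
  from tendsto_add[OF this e_lim]
  have AB: "((\<lambda>\<eta>. (A \<eta> - B \<eta>) * e \<eta>) \<longlongrightarrow> c - 1) (at_right 0)"
    by (simp add: algebra_simps)
  have "((\<lambda>\<eta>. 1 / (ln (m \<eta>) / L \<eta>) powr p * (B \<eta> + (A \<eta> - B \<eta>) * e \<eta> - A \<eta> * exp (- T \<eta>)))
      \<longlongrightarrow> 1 / 1 powr p * (1 + (c - 1) - \<gamma> * 0)) (at_right 0)"
    by (intro tendsto_intros lnm_L A B AB eT) auto
  then have "((\<lambda>\<eta>. 1 / (ln (m \<eta>) / L \<eta>) powr p * (B \<eta> + (A \<eta> - B \<eta>) * e \<eta> - A \<eta> * exp (- T \<eta>)))
      \<longlongrightarrow> c) (at_right 0)" by simp
  then have "\<forall>\<^sub>F \<eta> in at_right 0. c - \<delta>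
      < 1 / (ln (m \<eta>) / L \<eta>) powr p * (B \<eta> + (A \<eta> - B \<eta>) * e \<eta> - A \<eta> * exp (- T \<eta>))"
    using \<delta> by (intro order_tendstoD) auto
  then have "\<forall>\<^sub>F \<eta> in at_right 0. two_point_borel (\<epsilon> \<eta>) (m \<eta>) \<in> Fclass p \<eta> \<and>
      ennreal ((c - \<delta>) * (\<eta> powr p * L \<eta> powr (2 - p))) \<le> ideal_risk q (two_point (\<epsilon> \<eta>) (m \<eta>))"
    using evL evT evm evlnm ev\<epsilon> ev\<epsilon>1 ev\<eta>
  proof eventually_elim
    case (elim \<eta>)
    have D: "0 < \<eta> powr p * L \<eta> powr (2 - p)" using elim by simp
    have "(c - \<delta>) * (\<eta> powr p * L \<eta> powr (2 - p))
      \<le> (1 / (ln (m \<eta>) / L \<eta>) powr p * (B \<eta> + (A \<eta> - B \<eta>) * e \<eta> - A \<eta> * exp (- T \<eta>)))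
         * (\<eta> powr p * L \<eta> powr (2 - p))"
      using elim D by (intro mult_right_mono) auto
    also have "\<dots> = (\<eta> powr p * L \<eta> powr (2 - p) / (ln (m \<eta>) / L \<eta>) powr p)
        * (A \<eta> * (e \<eta> - exp (- T \<eta>)) + B \<eta> * (1 - e \<eta>))"
      by (simp add: algebra_simps add_divide_distrib)
    \<comment> \<open>Restores the mixing weight: the normalization and the factor
      \<open>(ln m / L) powr p\<close> combine to \<open>\<epsilon> * L^2\<close>, and the
      \<open>L^2\<close> cancels the denominators in \<open>A\<close> and \<open>B\<close>.\<close>
    also have "\<eta> powr p * L \<eta> powr (2 - p) / (ln (m \<eta>) / L \<eta>) powr p = \<epsilon> \<eta> * (L \<eta>)\<^sup>2"
    proof -
      have "L \<eta> powr (2 - p) * L \<eta> powr p = (L \<eta>)\<^sup>2"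
        using elim by (simp add: powr_add[symmetric])
      then show ?thesis using elim by (simp add: \<epsilon>_def powr_divide)
    qed
    also have "\<epsilon> \<eta> * (L \<eta>)\<^sup>2 * (A \<eta> * (e \<eta> - exp (- T \<eta>)) + B \<eta> * (1 - e \<eta>))
      = \<epsilon> \<eta> * ((1 - \<epsilon> \<eta>) * \<gamma> * (e \<eta> - exp (- T \<eta>)) * (ln (T \<eta>))\<^sup>2 + (1 - e \<eta>) * (ln (m \<eta>))\<^sup>2)"
      using elim by (simp add: A_def B_def power_divide distrib_left)
    finally have "ennreal ((c - \<delta>) * (\<eta> powr p * L \<eta> powr (2 - p)))
      \<le> ennreal (\<epsilon> \<eta> * ((1 - \<epsilon> \<eta>) * \<gamma> * (e \<eta> - exp (- T \<eta>)) * (ln (T \<eta>))\<^sup>2 + (1 - e \<eta>) * (ln (m \<eta>))\<^sup>2))"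
      by (rule ennreal_leI)
    also have "\<dots> \<le> ideal_risk q (two_point (\<epsilon> \<eta>) (m \<eta>))"
      using two_point_risk_ge[OF q, of "\<epsilon> \<eta>" "m \<eta>"] elim by (simp add: \<gamma>_def T_def e_def)
    finally show ?case
      using two_point_borel_Fclass[OF p(1) _ \<epsilon>_def] elim by simp
  qed
  then show ?thesis unfolding \<epsilon>_def c_def \<gamma>_def L_def l_def .
qed

section \<open>Limits\<close>

text \<open>A sandwich between \<open>c - \<delta>\<close> and \<open>c + \<delta>\<close>. The
  second conclusion, finiteness of \<open>S\<close>, allows quotients in \<open>ennreal\<close> to
  be computed in the reals.\<close>

lemma tendsto_enn2real_ratio:
  fixes S :: "'a \<Rightarrow> ennreal" and D :: "'a \<Rightarrow> real"
  assumes upper: "\<And>\<delta>. 0 < \<delta> \<Longrightarrow> \<forall>\<^sub>F x in F. S x \<le> ennreal ((c + \<delta>) * D x)"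
    and lower: "\<And>\<delta>. 0 < \<delta> \<Longrightarrow> \<forall>\<^sub>F x in F. ennreal ((c - \<delta>) * D x) \<le> S x"
    and D: "\<forall>\<^sub>F x in F. 0 < D x" and c: "0 < c"
  shows "((\<lambda>x. enn2real (S x) / D x) \<longlongrightarrow> c) F" "\<forall>\<^sub>F x in F. S x = ennreal (enn2real (S x))"
proof -
  show fin: "\<forall>\<^sub>F x in F. S x = ennreal (enn2real (S x))"
    using upper[OF zero_less_one]
    by eventually_elim (metis ennreal_enn2real ennreal_less_top order_le_less_trans)
  show "((\<lambda>x. enn2real (S x) / D x) \<longlongrightarrow> c) F"
  proof (rule tendstoI)
    fix e :: real assume e: "0 < e"
    define d where "d = min (e / 2) (c / 2)"
    have d: "0 < d" "d < e" "d < c" using e c by (auto simp: d_def min_def)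
    from upper[OF d(1)] lower[OF d(1)] D fin
    show "\<forall>\<^sub>F x in F. dist (enn2real (S x) / D x) c < e"
    proof eventually_elim
      case (elim x)
      define s where "s = enn2real (S x)"
      have s: "S x = ennreal s" "0 \<le> s" using elim by (auto simp: s_def)
      have "s \<le> (c + d) * D x" using elim(1,3) s d by (simp add: ennreal_le_iff)
      moreover have "(c - d) * D x \<le> s" using elim(2) s by (simp add: ennreal_le_iff)
      ultimately have "c - d \<le> s / D x" "s / D x \<le> c + d"
        using elim(3) by (auto simp: le_divide_eq divide_le_eq)
      then show ?case using d by (auto simp: dist_real_def s_def)
    qed
  qed
qed

theorem theorem5p1:
  fixes q p :: real
  assumes "0 < q" "q < 1" "0 < p" "p < 2"
  shows "((\<lambda>\<eta>. (SUP F\<in>Fclass p \<eta>. ideal_risk q F)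
            / ennreal (\<eta> powr p * (ln (ln (1 / \<eta>))) powr (2 - p)))
          \<longlongrightarrow> ennreal (if q \<le> 1/2 then 1 else q / (1 - q))) (at_right 0)
       \<and> (\<forall>s\<in>{0..1::real}.
           let mub = (\<lambda>\<eta>::real. ln (1 / \<eta>) / ln (ln (1 / \<eta>)));
               muv = (\<lambda>\<eta>::real. ln (1 / \<eta>) * ln (ln (1 / \<eta>)));
               mut = (\<lambda>\<eta>. if q < 1/2 then mub \<eta> else if q > 1/2 then muv \<eta>
                          else (1 - s) * mub \<eta> + s * muv \<eta>)
           in ((\<lambda>\<eta>. ideal_risk q (two_point (\<eta> powr p / (ln (mut \<eta>)) powr p) (mut \<eta>))
                   / (SUP F\<in>Fclass p \<eta>. ideal_risk q F))
               \<longlongrightarrow> 1) (at_right 0))"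
proof -
  note q = assms(1,2) and p = assms(3,4)
  define c where "c = (if q \<le> 1/2 then 1 else q / (1 - q))"
  define S where "S \<eta> = (SUP F\<in>Fclass p \<eta>. ideal_risk q F)" for \<eta>
  define D where "D \<eta> = \<eta> powr p * (ln (ln (1 / \<eta>))) powr (2 - p)" for \<eta>
  define mub where "mub \<eta> = ln (1 / \<eta>) / ln (ln (1 / \<eta>))" for \<eta> :: real
  define muv where "muv \<eta> = ln (1 / \<eta>) * ln (ln (1 / \<eta>))" for \<eta> :: real
  define mut where "mut s \<eta> = (if q < 1/2 then mub \<eta> else if q > 1/2 then muv \<eta>
     else (1 - s) * mub \<eta> + s * muv \<eta>)" for s \<eta>
  define R where "R s \<eta> = ideal_risk q (two_point (\<eta> powr p / (ln (mut s \<eta>)) powr p) (mut s \<eta>))" for s \<eta>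
  have c0: "0 < c" using q by (simp add: c_def)
  have c_max: "c = max 1 (q / (1 - q))"
  proof (cases "q \<le> 1/2")
    case True
    then have "q / (1 - q) \<le> 1" using q by (simp add: divide_le_eq)
    then show ?thesis using True by (simp add: c_def)
  next
    case False
    then have "1 \<le> q / (1 - q)" using q by (simp add: le_divide_eq)
    then show ?thesis using False by (simp add: c_def)
  qed
  have D0: "\<forall>\<^sub>F \<eta> in at_right 0. 0 < D \<eta>" unfolding D_def by real_asymp
  have upper: "\<forall>\<^sub>F \<eta> in at_right 0. S \<eta> \<le> ennreal ((c + \<delta>) * D \<eta>)" if "0 < \<delta>" for \<delta>
    using ideal_risk_upper[OF p q that] unfolding S_def D_def c_max
    by eventually_elim (auto intro: SUP_least)
  \<comment> \<open>One chain serves both claims: the two-point risk bounds the supremum from below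
    and is itself asymptotically as large.\<close>
  have lower: "\<forall>\<^sub>F \<eta> in at_right 0. ennreal ((c - \<delta>) * D \<eta>) \<le> R s \<eta> \<and> R s \<eta> \<le> S \<eta>"
    if "0 < \<delta>" and s: "s \<in> {0..1}" for \<delta> s
  proof -
    have mm: "\<forall>\<^sub>F \<eta> in at_right 0. mub \<eta> \<le> muv \<eta>" unfolding mub_def muv_def by real_asymp
    have m: "\<forall>\<^sub>F \<eta> in at_right 0. mub \<eta> \<le> mut s \<eta> \<and> mut s \<eta> \<le> muv \<eta>"
      using mm
    proof eventually_elim
      case (elim \<eta>)
      have "s * mub \<eta> \<le> s * muv \<eta>" "(1 - s) * mub \<eta> \<le> (1 - s) * muv \<eta>"
        using s elim by (auto intro!: mult_left_mono)
      then show ?case using elim by (auto simp: mut_def algebra_simps)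
    qed
    have "\<forall>\<^sub>F \<eta> in at_right 0.
        two_point_borel (\<eta> powr p / ln (mut s \<eta>) powr p) (mut s \<eta>) \<in> Fclass p \<eta> \<and>
        ennreal (((if q \<le> 1/2 then 1 else q / (1 - q)) - \<delta>) * (\<eta> powr p * ln (ln (1 / \<eta>)) powr (2 - p)))
          \<le> ideal_risk q (two_point (\<eta> powr p / ln (mut s \<eta>) powr p) (mut s \<eta>))"
    proof (rule two_point_risk_lower[OF q p])
      show "\<forall>\<^sub>F \<eta> in at_right 0. ln (1 / \<eta>) / ln (ln (1 / \<eta>)) \<le> mut s \<eta>"
        using m by eventually_elim (simp add: mub_def)
      show "\<forall>\<^sub>F \<eta> in at_right 0. mut s \<eta> \<le> ln (1 / \<eta>) * ln (ln (1 / \<eta>))"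
        using m by eventually_elim (simp add: muv_def)
      have "filterlim (\<lambda>\<eta>. ln (1 / \<eta>) / mub \<eta>) at_top (at_right 0)"
        unfolding mub_def by real_asymp
      moreover have "((\<lambda>\<eta>. ln (1 / \<eta>) / muv \<eta>) \<longlongrightarrow> 0) (at_right 0)"
        unfolding muv_def by real_asymp
      ultimately show "q = 1/2
        \<or> q < 1/2 \<and> filterlim (\<lambda>\<eta>. ln (1 / \<eta>) / mut s \<eta>) at_top (at_right 0)
        \<or> 1/2 < q \<and> ((\<lambda>\<eta>. ln (1 / \<eta>) / mut s \<eta>) \<longlongrightarrow> 0) (at_right 0)"
        by (cases q "1/2 :: real" rule: linorder_cases) (auto simp: mut_def)
    qed fact
    then show ?thesis
    proof eventually_elim
      case (elim \<eta>)
      then have "R s \<eta> \<le> S \<eta>"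
        unfolding R_def S_def ideal_risk_two_point_borel[symmetric] by (intro SUP_upper) simp
      then show ?case using elim by (simp add: R_def c_def D_def)
    qed
  qed
  \<comment> \<open>Any \<open>s\<close> would do; \<open>s = 0\<close> supplies a witness for the
    first claim.\<close>
  have S_lower: "\<forall>\<^sub>F \<eta> in at_right 0. ennreal ((c - \<delta>) * D \<eta>) \<le> S \<eta>" if "0 < \<delta>" for \<delta>
    using lower[OF that, of 0] by (auto elim: eventually_mono intro: order_trans)
  have S_lim: "((\<lambda>\<eta>. enn2real (S \<eta>) / D \<eta>) \<longlongrightarrow> c) (at_right 0)"
    "\<forall>\<^sub>F \<eta> in at_right 0. S \<eta> = ennreal (enn2real (S \<eta>))"
    using tendsto_enn2real_ratio[OF upper S_lower D0 c0] by auto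
  have "((\<lambda>\<eta>. ennreal (enn2real (S \<eta>) / D \<eta>)) \<longlongrightarrow> ennreal c) (at_right 0)"
    by (intro tendsto_ennrealI S_lim)
  then have 1: "((\<lambda>\<eta>. S \<eta> / ennreal (D \<eta>)) \<longlongrightarrow> ennreal c) (at_right 0)"
  proof (rule Lim_transform_eventually)
    show "\<forall>\<^sub>F \<eta> in at_right 0. ennreal (enn2real (S \<eta>) / D \<eta>) = S \<eta> / ennreal (D \<eta>)"
      using S_lim(2) D0 by eventually_elim (metis divide_ennreal enn2real_nonneg)
  qed
  have 2: "((\<lambda>\<eta>. R s \<eta> / S \<eta>) \<longlongrightarrow> 1) (at_right 0)" if s: "s \<in> {0..1}" for s
  proof -
    have R_upper: "\<forall>\<^sub>F \<eta> in at_right 0. R s \<eta> \<le> ennreal ((c + \<delta>) * D \<eta>)" if "0 < \<delta>" for \<delta>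
      using upper[OF that] lower[OF that s] by eventually_elim (auto intro: order_trans)
    have R_lower: "\<forall>\<^sub>F \<eta> in at_right 0. ennreal ((c - \<delta>) * D \<eta>) \<le> R s \<eta>" if "0 < \<delta>" for \<delta>
      using lower[OF that s] by (auto elim: eventually_mono)
    have R_lim: "((\<lambda>\<eta>. enn2real (R s \<eta>) / D \<eta>) \<longlongrightarrow> c) (at_right 0)"
      "\<forall>\<^sub>F \<eta> in at_right 0. R s \<eta> = ennreal (enn2real (R s \<eta>))"
      using tendsto_enn2real_ratio[OF R_upper R_lower D0 c0] by auto
    have pos: "\<forall>\<^sub>F \<eta> in at_right 0. 0 < enn2real (S \<eta>) / D \<eta>"
      using S_lim(1) c0 by (rule order_tendstoD)
    \<comment> \<open>Numerator and denominator have the same positive limit \<open>c\<close>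
      relative to \<open>D\<close>, so their quotient tends to 1.\<close>
    have "((\<lambda>\<eta>. ennreal ((enn2real (R s \<eta>) / D \<eta>) / (enn2real (S \<eta>) / D \<eta>))) \<longlongrightarrow> ennreal (c / c)) (at_right 0)"
      using c0 by (intro tendsto_ennrealI tendsto_divide R_lim S_lim) auto
    then have "((\<lambda>\<eta>. ennreal ((enn2real (R s \<eta>) / D \<eta>) / (enn2real (S \<eta>) / D \<eta>))) \<longlongrightarrow> 1) (at_right 0)"
      using c0 by simp
    then show ?thesis
    proof (rule Lim_transform_eventually)
      show "\<forall>\<^sub>F \<eta> in at_right 0. ennreal ((enn2real (R s \<eta>) / D \<eta>) / (enn2real (S \<eta>) / D \<eta>)) = R s \<eta> / S \<eta>"
        using S_lim(2) R_lim(2) D0 pos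
      proof eventually_elim
        case (elim \<eta>)
        then have "0 < enn2real (S \<eta>)" by (simp add: zero_less_divide_iff)
        then have "R s \<eta> / S \<eta> = ennreal (enn2real (R s \<eta>) / enn2real (S \<eta>))"
          using elim by (metis divide_ennreal enn2real_nonneg)
        then show ?case using elim by simp
      qed
    qed
  qed
  show ?thesis
    using 1 2 unfolding c_def S_def D_def R_def mut_def mub_def muv_def Let_def by blast
qed

end
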